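(* Let $\mathcal B(n,l)$ be the reflection algebra with generating matrix $B(u)=\sum_{p,q}E_{pq}\otimes b_p^q(u)$, and let $\operatorname{sdet}B(u)$ be its Sklyanin determinant. Then $$\operatorname{sdet} B(u)=\sum_{\eta\in I_n}\ \sum_{\sigma\in S(\eta)}\alpha(\sigma,\eta)\, b^{1,\dots,n}_{\sigma(1),\dots,\sigma(n)}(u,\eta),$$ where $$\alpha(\sigma,\eta)=(-1)^{\sigma}\prod_{i:\, i<\eta_i}\frac{1}{2u+2-i-n},$$ $(-1)^\sigma$ is the sign of $\sigma$, and $b^{1,\dots,n}_{\sigma(1),\dots,\sigma(n)}(u,\eta)$ is the corresponding matrix coefficient (with lower indices $p_i=\sigma(i)$ and upper indices $q_i=i$) of the product $B_{\eta_1}(u)B_{\eta_2}(u-1)\cdots B_{\eta_n}(u-n+1)$. This coefficient can be computed by the rule $$b^{1,\dots,n}_{\sigma(1),\dots,\sigma(n)}(u,\eta)=\prod_{k=1}^{n} b_{p(k)}^{q(k)}(u-k+1)$$ (factors ordered from left to right by increasing $k$), where $$p(k)=\begin{cases}\sigma(\eta(k)) & \text{if } k\in G_\eta^-,\\ s_k & \text{otherwise,}\end{cases}\qquad q(k)=\begin{cases}\eta(k) & \text{if } k\in G_\eta^+,\\ s_{\gamma_\eta(k)} & \text{otherwise,}\end{cases}$$ and the Einstein summation convention is used for the indices $s_t$: whenever a repeated index $s_t$ occurs in the product, the monomials are summed over $s_t=1,\dots,n$.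
   Context: Reflection algebra. Let $n=m+l$ with $m,l$ nonnegative integers, and $\varepsilon_i=1$ for $1\le i\le m$, $\varepsilon_i=-1$ for $m<i\le n$. Let $P:v\otimes w\mapsto w\otimes v$ on $\mathbb C^n\otimes\mathbb C^n$ and $R(u)=1-P/u$. The reflection algebra $\mathcal B(n,l)$ is the unital associative algebra over $\mathbb C$ with generators $b_{ij}^{(r)}$ ($i,j=1,\dots,n$, $r=0,1,2,\dots$), $b_{ij}^{(0)}=\delta_{ij}\varepsilon_i$, collected into series $b_i^j(u)=\sum_{r\ge0}b_{ij}^{(r)}u^{-r}$ and the matrix $B(u)=\sum_{i,j}E_{ij}\otimes b_i^j(u)\in\operatorname{End}\mathbb C^n\otimes\mathcal B(n,l)[[u^{-1}]]$, subject to the reflection equation $R(u-v)B_1(u)R(u+v)B_2(v)=B_2(v)R(u+v)B_1(u)R(u-v)$ and the unitary condition $B(u)B(-u)=1$. For a matrix $X=(x_{ij})$ over an associative algebra $A$, $X_s=\sum_{i,j}1\otimes\cdots\otimes E_{ij}\otimes\cdots\otimes1\otimes x_{ij}\in\operatorname{End}(\mathbb C^n)^{\otimes k}\otimes A$ with $E_{ij}$ in the $s$-th position; $P_{ij}$ and $R_{ij}(u)$ denote $P$ and $R(u)$ acting on the $i$-th and $j$-th copies of $\mathbb C^n$. Shifted series and rational functions of $u$ are expanded as power series in $u^{-1}$. Sklyanin determinant. Abbreviate $R_{ij}:=R_{ij}(2u-i-j+2)$, and put $\langle B_1,\dots,B_n\rangle=B_1(u)(R_{12}\cdots R_{1n})B_2(u-1)(R_{23}\cdots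 R_{2n})\cdots B_n(u-n+1)$. Let $A_n(v_1\otimes\cdots\otimes v_n)=\sum_{\sigma\in S_n}(-1)^\sigma v_{\sigma(1)}\otimes\cdots\otimes v_{\sigma(n)}$ (no normalization). It is known that $A_n\langle B_1,\dots,B_n\rangle$ equals $A_n$ times a series in $u^{-1}$ with coefficients in $\mathcal B(n,l)$; this series is $\operatorname{sdet}B(u)$, i.e. $A_n\langle B_1,\dots,B_n\rangle=\operatorname{sdet}B(u)\,A_n$. Combinatorial data. $I_n\subset\mathbb Z^n$ is the set of $n$-tuples $\eta=(\eta_1,\dots,\eta_n)$ with $i\le\eta_i\le n$ for all $i$. View $\eta$ as a function $\{1,\dots,n\}\to\{1,\dots,n\}$, $\eta(i)=\eta_i$. Let $N_1,\dots,N_K$ be the distinct elements of $\operatorname{Im}(\eta)$, and let $\eta^{-1}(N_j)=\{a_{j,1}<\cdots<a_{j,m_j}\}$. Let $\Gamma_j=(a_{j,1},\dots,a_{j,m_j})\in S_n$ be the corresponding cycle (sending $a_{j,1}\mapsto a_{j,2}\mapsto\cdots\mapsto a_{j,m_j}\mapsto a_{j,1}$), and $\gamma_\eta=\Gamma_1\cdots\Gamma_K$. Put $G_\eta^-=\{a_{j,1}\}_{j=1}^K$ and $G_\eta^+=\{a_{j,m_j}\}_{j=1}^K$ (minimal and maximal elements of the cycles). $S(\eta)$ is the subgroup of $S_n$ of permutations acting trivially on the complement of $\operatorname{Im}(\eta)$ in $\{1,\dots,n\}$. Matrix coefficients $b_{p_1,\dots,p_n}^{q_1,\dots,q_n}(u,\eta)$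 are defined by $$B_{\eta_1}(u)B_{\eta_2}(u-1)\cdots B_{\eta_n}(u-n+1)=\sum_{p_1,\dots,p_n,\,q_1,\dots,q_n}E_{p_1q_1}\otimes\cdots\otimes E_{p_nq_n}\otimes b_{p_1,\dots,p_n}^{q_1,\dots,q_n}(u,\eta).$$ *)

theory Defs
  imports
    Complex_Main
    "HOL-Library.Poly_Mapping"
    "HOL-Library.FuncSet"
    "HOL-Library.Type_Length"
    "HOL-Computational_Algebra.Formal_Power_Series"
    "HOL-Combinatorics.Permutations"
    "HOL-Combinatorics.Cycles"
begin

unbundle fps_syntax

section \<open>Operators on tensor powers\<close>

text \<open>
  The basis vectors of the \<open>k\<close>-th tensor power of \<open>\<complex>\<^sup>n\<close> are indexed by \<open>multi_idx n k\<close>.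
  An element of \<open>End(\<complex>\<^sup>n)\<^sup>\<otimes>\<^sup>k \<otimes> A\<close> is the family of its matrix coefficients: the value at
  \<open>p q\<close> is the coefficient of \<open>E\<^bsub>p(1)q(1)\<^esub> \<otimes> \<dots> \<otimes> E\<^bsub>p(k)q(k)\<^esub>\<close>. Only the values at
  \<open>p, q \<in> multi_idx n k\<close> are meaningful.
\<close>

type_synonym 'a tens = "(nat \<Rightarrow> nat) \<Rightarrow> (nat \<Rightarrow> nat) \<Rightarrow> 'a"

definition multi_idx :: "nat \<Rightarrow> nat \<Rightarrow> (nat \<Rightarrow> nat) set" where
  "multi_idx n k = {1..k} \<rightarrow>\<^sub>E {1..n}"

definition tens_one :: "'a::ring_1 tens" where
  "tens_one p q = (if p = q then 1 else 0)"

definition tens_mult :: "nat \<Rightarrow> nat \<Rightarrow> 'a::ring_1 tens \<Rightarrow> 'a tens \<Rightarrow> 'a tens" where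
  "tens_mult n k X Y p q = (\<Sum>r\<in>multi_idx n k. X p r * Y r q)"

definition tens_prod :: "nat \<Rightarrow> nat \<Rightarrow> 'a::ring_1 tens list \<Rightarrow> 'a tens" where
  "tens_prod n k Xs = foldr (tens_mult n k) Xs tens_one"

text \<open>\<open>tens_at k s X\<close> is \<open>X\<^sub>s\<close>, the matrix \<open>X\<close> acting on the \<open>s\<close>-th of \<open>k\<close> tensor factors.\<close>

definition tens_at :: "nat \<Rightarrow> nat \<Rightarrow> (nat \<Rightarrow> nat \<Rightarrow> 'a::ring_1) \<Rightarrow> 'a tens" where
  "tens_at k s X p q = (if \<forall>t\<in>{1..k} - {s}. p t = q t then X (p s) (q s) else 0)"

definition tens_swap :: "nat \<Rightarrow> nat \<Rightarrow> 'a::ring_1 tens" where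
  "tens_swap i j p q = (if p = q \<circ> Transposition.transpose i j then 1 else 0)"

text \<open>The unnormalised antisymmetrizer \<open>A\<^sub>n\<close>: it sends \<open>e\<^bsub>q(1)\<^esub> \<otimes> \<dots> \<otimes> e\<^bsub>q(n)\<^esub>\<close> to the
  signed sum of the vectors \<open>e\<^bsub>q(\<sigma>(1))\<^esub> \<otimes> \<dots> \<otimes> e\<^bsub>q(\<sigma>(n))\<^esub>\<close>.\<close>

definition antisymmetrizer :: "nat \<Rightarrow> 'a::ring_1 tens" where
  "antisymmetrizer n p q =
     (\<Sum>\<sigma> | \<sigma> permutes {1..n}. of_int (sign \<sigma>) * (if p = q \<circ> \<sigma> then 1 else 0))"


section \<open>The defining relations\<close>

text \<open>
  Both relations are stated for an arbitrary family \<open>b i j r\<close> standing for \<open>b\<^bsub>ij\<^esub>\<^sup>(\<^sup>r\<^sup>)\<close>.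
  Power series in \<open>x = u\<^sup>-\<^sup>1\<close> and \<open>y = v\<^sup>-\<^sup>1\<close> are elements of \<open>'a fps fps\<close>, with \<open>x\<close> as the
  outer and \<open>y\<close> as the inner variable.

  Since \<open>1/(u - v) = xy/(y - x)\<close> and \<open>1/(u + v) = xy/(x + y)\<close>, we have
  \<open>(y - x) R(u - v) = (y - x) - xy P\<close> and \<open>(x + y) R(u + v) = (x + y) - xy P\<close>. The reflection
  equation is multiplied by \<open>(y - x)(x + y)\<close>, a central element that is not a zero divisor, so
  that both sides have coefficients in the ring of power series.
\<close>

definition reflection_defect ::
    "nat \<Rightarrow> (nat \<Rightarrow> nat \<Rightarrow> nat \<Rightarrow> 'a::ring_1) \<Rightarrow> 'a fps fps tens" where
  "reflection_defect n b p q =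
    (let x = fps_X;
         y = fps_const fps_X;
         R_minus = (\<lambda>p q. (y - x) * tens_one p q - x * y * tens_swap 1 2 p q);
         R_plus = (\<lambda>p q. (x + y) * tens_one p q - x * y * tens_swap 1 2 p q);
         B1_u = tens_at 2 1 (\<lambda>i j. Abs_fps (\<lambda>r. fps_const (b i j r)));
         B2_v = tens_at 2 2 (\<lambda>i j. fps_const (Abs_fps (b i j)))
     in tens_prod n 2 [R_minus, B1_u, R_plus, B2_v] p q -
        tens_prod n 2 [B2_v, R_plus, B1_u, R_minus] p q)"

text \<open>The entries of \<open>B(u) B(-u) - 1\<close>.\<close>

definition unitarity_defect ::
    "nat \<Rightarrow> (nat \<Rightarrow> nat \<Rightarrow> nat \<Rightarrow> 'a::ring_1) \<Rightarrow> nat \<Rightarrow> nat \<Rightarrow> 'a fps" where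
  "unitarity_defect n b i j =
     (\<Sum>k\<in>{1..n}. Abs_fps (b i k) * Abs_fps (\<lambda>r. (- 1) ^ r * b k j r)) - (if i = j then 1 else 0)"


section \<open>Free algebras and two-sided ideals\<close>

datatype 'a word = Word (letters: "'a list")

instantiation word :: (type) monoid_add
begin

definition "0 = Word []"
definition "v + w = Word (letters v @ letters w)"

instance
  by standard (simp_all add: zero_word_def plus_word_def)

end

text \<open>The monoid algebra over \<open>\<complex>\<close> of the free monoid on \<open>'g\<close>, with the convolution product.\<close>

type_synonym 'g free_algebra = "'g word \<Rightarrow>\<^sub>0 complex"

abbreviation free_gen :: "'g \<Rightarrow> 'g free_algebra" where
  "free_gen g \<equiv> Poly_Mapping.single (Word [g]) 1"

abbreviation free_scalar :: "complex \<Rightarrow> 'g free_algebra" where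
  "free_scalar c \<equiv> Poly_Mapping.single 0 c"

inductive_set two_sided_ideal :: "'a::ring_1 set \<Rightarrow> 'a set" for S where
  zero: "0 \<in> two_sided_ideal S"
| gen: "s \<in> S \<Longrightarrow> a * s * b \<in> two_sided_ideal S"
| add: "x \<in> two_sided_ideal S \<Longrightarrow> y \<in> two_sided_ideal S \<Longrightarrow> x + y \<in> two_sided_ideal S"

lemma two_sided_ideal_mult:
  assumes "x \<in> two_sided_ideal S"
  shows "c * x * d \<in> two_sided_ideal S"
  using assms
proof induction
  case (gen s a b)
  have "c * (a * s * b) * d = (c * a) * s * (b * d)"
    by (simp add: mult.assoc)
  then show ?case
    using gen two_sided_ideal.gen by metis
qed (auto simp: algebra_simps intro: two_sided_ideal.zero two_sided_ideal.add)

lemma two_sided_ideal_uminus: "x \<in> two_sided_ideal S \<Longrightarrow> - x \<in> two_sided_ideal S"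
  using two_sided_ideal_mult[of x S "- 1" 1] by simp

lemma two_sided_ideal_diff:
  "x \<in> two_sided_ideal S \<Longrightarrow> y \<in> two_sided_ideal S \<Longrightarrow> x - y \<in> two_sided_ideal S"
  using two_sided_ideal.add[of x S "- y"] two_sided_ideal_uminus[of y S] by simp

lemma two_sided_ideal_cong_mult:
  assumes "x - x' \<in> two_sided_ideal S" "y - y' \<in> two_sided_ideal S"
  shows "x * y - x' * y' \<in> two_sided_ideal S"
proof -
  have "x * y - x' * y' = 1 * (x - x') * y + x' * (y - y') * 1"
    by (simp add: algebra_simps)
  then show ?thesis
    using assms by (metis two_sided_ideal_mult two_sided_ideal.add)
qed

lemma two_sided_ideal_cong_add:
  assumes "x - x' \<in> two_sided_ideal S" "y - y' \<in> two_sided_ideal S"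
  shows "(x + y) - (x' + y') \<in> two_sided_ideal S"
  using two_sided_ideal.add[OF assms] by (simp add: algebra_simps)

lemma two_sided_ideal_cong_diff:
  assumes "x - x' \<in> two_sided_ideal S" "y - y' \<in> two_sided_ideal S"
  shows "(x - y) - (x' - y') \<in> two_sided_ideal S"
  using two_sided_ideal_diff[OF assms] by (simp add: algebra_simps)

lemma two_sided_ideal_cong_uminus:
  assumes "x - x' \<in> two_sided_ideal S"
  shows "- x - (- x') \<in> two_sided_ideal S"
  using two_sided_ideal_uminus[OF assms] by simp

lemma equivp_two_sided_ideal: "equivp (\<lambda>x y. x - y \<in> two_sided_ideal S)"
proof (intro equivpI reflpI sympI transpI)
  show "x - x \<in> two_sided_ideal S" for x
    by (simp add: two_sided_ideal.zero)
  show "y - x \<in> two_sided_ideal S" if "x - y \<in> two_sided_ideal S" for x y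
    using two_sided_ideal_uminus[OF that] by simp
  show "x - z \<in> two_sided_ideal S"
    if "x - y \<in> two_sided_ideal S" "y - z \<in> two_sided_ideal S" for x y z
    using two_sided_ideal.add[OF that] by simp
qed


section \<open>The reflection algebra\<close>

type_synonym refl_gen = "nat \<times> nat \<times> nat"

text \<open>
  The free algebra has a generator for each triple \<open>(i, j, r)\<close> of natural numbers; the first set
  of relators removes those whose indices are not in \<open>{1..n}\<close>.
\<close>

definition reflection_relators :: "nat \<Rightarrow> nat \<Rightarrow> refl_gen free_algebra set" where
  "reflection_relators m l =
    (let n = m + l; b = (\<lambda>i j r. free_gen (i, j, r)) in
      {b i j r | i j r. \<not> (i \<in> {1..n} \<and> j \<in> {1..n})} \<union>
      {b i j 0 - free_scalar (if i = j then if i \<le> m then 1 else - 1 else 0) | i j.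
         i \<in> {1..n} \<and> j \<in> {1..n}} \<union>
      {reflection_defect n b p q $ r $ s | p q r s. p \<in> multi_idx n 2 \<and> q \<in> multi_idx n 2} \<union>
      {unitarity_defect n b i j $ r | i j r. i \<in> {1..n} \<and> j \<in> {1..n}})"

subsection \<open>The relations are consistent\<close>

text \<open>
  The class \<open>ring_1\<close> requires \<open>0 \<noteq> 1\<close>. This holds in the quotient because
  \<open>B(u) \<mapsto> diag(\<epsilon>\<^sub>1, \<dots>, \<epsilon>\<^sub>n)\<close> satisfies the relations in \<open>\<complex>\<close>.
\<close>

definition free_eval :: "('g \<Rightarrow> complex) \<Rightarrow> 'g free_algebra \<Rightarrow> complex" where
  "free_eval g f = (\<Sum>w\<in>Poly_Mapping.keys f. Poly_Mapping.lookup f w * prod_list (map g (letters w)))"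

lemma free_eval_superset:
  assumes "finite W" "Poly_Mapping.keys f \<subseteq> W"
  shows "free_eval g f = (\<Sum>w\<in>W. Poly_Mapping.lookup f w * prod_list (map g (letters w)))"
  unfolding free_eval_def
  using assms by (intro sum.mono_neutral_left) (auto simp: in_keys_iff)

lemma free_eval_add: "free_eval g (x + y) = free_eval g x + free_eval g y"
proof -
  have "Poly_Mapping.keys (x + y) \<subseteq> Poly_Mapping.keys x \<union> Poly_Mapping.keys y"
    by (rule Poly_Mapping.keys_add)
  then show ?thesis
    by (subst (1 2 3) free_eval_superset[of "Poly_Mapping.keys x \<union> Poly_Mapping.keys y"])
       (auto simp: lookup_add distrib_right sum.distrib)
qed

lemma free_eval_single:
  "free_eval g (Poly_Mapping.single w c) = c * prod_list (map g (letters w))"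
  by (subst free_eval_superset[of "{w}"]) (auto simp: lookup_single)

lemma free_eval_zero: "free_eval g 0 = 0"
  by (simp add: free_eval_def)

lemma free_eval_sum: "free_eval g (\<Sum>i\<in>I. f i) = (\<Sum>i\<in>I. free_eval g (f i))"
  by (induction I rule: infinite_finite_induct) (simp_all add: free_eval_zero free_eval_add)

lemma poly_mapping_eq_sum_single:
  "f = (\<Sum>w\<in>Poly_Mapping.keys f. Poly_Mapping.single w (Poly_Mapping.lookup f w))"
proof (rule poly_mapping_eqI)
  fix w
  show "Poly_Mapping.lookup f w = Poly_Mapping.lookup (\<Sum>w\<in>Poly_Mapping.keys f. Poly_Mapping.single w (Poly_Mapping.lookup f w)) w"
    by (simp add: lookup_sum lookup_single when_def in_keys_iff)
qed

lemma free_eval_mult: "free_eval g (x * y) = free_eval g x * free_eval g y"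
proof -
  have "x * y = (\<Sum>v\<in>Poly_Mapping.keys x. Poly_Mapping.single v (Poly_Mapping.lookup x v)) *
                (\<Sum>w\<in>Poly_Mapping.keys y. Poly_Mapping.single w (Poly_Mapping.lookup y w))"
    by (intro arg_cong2[where f = times] poly_mapping_eq_sum_single)
  also have "\<dots> = (\<Sum>v\<in>Poly_Mapping.keys x. \<Sum>w\<in>Poly_Mapping.keys y. Poly_Mapping.single (v + w) (Poly_Mapping.lookup x v * Poly_Mapping.lookup y w))"
    by (simp add: sum_product mult_single)
  finally show ?thesis
    by (simp add: free_eval_sum free_eval_single plus_word_def)
       (simp add: free_eval_def sum_product mult_ac)
qed

lemma free_eval_one: "free_eval g 1 = 1"
proof -
  have "free_eval g (Poly_Mapping.single 0 1) = 1"
    unfolding free_eval_single by (simp add: zero_word_def)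
  then show ?thesis by simp
qed

definition is_ring_hom :: "('a::ring_1 \<Rightarrow> 'b::ring_1) \<Rightarrow> bool" where
  "is_ring_hom h \<longleftrightarrow> h 1 = 1 \<and> (\<forall>x y. h (x + y) = h x + h y) \<and> (\<forall>x y. h (x * y) = h x * h y)"

lemma is_ring_hom_simps:
  assumes "is_ring_hom h"
  shows "h 1 = 1" "h (x + y) = h x + h y" "h (x * y) = h x * h y" "h 0 = 0"
    "h (- x) = - h x" "h (x - y) = h x - h y" "h (sum f I) = (\<Sum>i\<in>I. h (f i))"
    "h (if P then x else y) = (if P then h x else h y)" "h (x ^ r) = h x ^ r"
proof -
  show *: "h 1 = 1" "h (x + y) = h x + h y" "h (x * y) = h x * h y" for x y
    using assms by (auto simp: is_ring_hom_def)
  show 0: "h 0 = 0"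
    using *(2)[of 0 0] by simp
  show m: "h (- x) = - h x" for x
    using *(2)[of x "- x"] 0 by (simp add: eq_neg_iff_add_eq_0 add.commute)
  show "h (x - y) = h x - h y"
    using *(2)[of x "- y"] m by simp
  show "h (sum f I) = (\<Sum>i\<in>I. h (f i))"
    by (induction I rule: infinite_finite_induct) (simp_all add: 0 *)
  show "h (x ^ r) = h x ^ r"
    by (induction r) (simp_all add: *)
qed auto

definition fps_hom :: "('a \<Rightarrow> 'b) \<Rightarrow> 'a fps \<Rightarrow> 'b fps" where
  "fps_hom h f = Abs_fps (\<lambda>k. h (f $ k))"

lemma is_ring_hom_fps_hom:
  assumes "is_ring_hom h"
  shows "is_ring_hom (fps_hom h)"
  unfolding is_ring_hom_def fps_hom_def
  by (auto simp: fps_eq_iff fps_mult_nth is_ring_hom_simps[OF assms] fps_one_def)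

lemma tens_prod_hom:
  assumes "is_ring_hom h"
  shows "h (tens_prod n k Xs p q) = tens_prod n k (map (\<lambda>X p q. h (X p q)) Xs) p q"
proof (induction Xs arbitrary: p q)
  case Nil
  show ?case
    by (simp add: tens_prod_def tens_one_def is_ring_hom_simps[OF assms])
next
  case (Cons X Xs)
  have "h (tens_prod n k (X # Xs) p q)
      = (\<Sum>r\<in>multi_idx n k. h (X p r) * h (tens_prod n k Xs r q))"
    by (simp add: tens_prod_def tens_mult_def is_ring_hom_simps[OF assms])
  then show ?case
    using Cons by (simp add: tens_prod_def tens_mult_def)
qed

lemma fps_hom_simps:
  assumes "is_ring_hom h"
  shows "fps_hom h fps_X = fps_X" "fps_hom h (fps_const c) = fps_const (h c)"
    "fps_hom h (Abs_fps f) = Abs_fps (\<lambda>k. h (f k))"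
  by (auto simp: fps_hom_def fps_eq_iff is_ring_hom_simps[OF assms] fps_X_def)

lemma reflection_defect_hom:
  assumes h: "is_ring_hom h"
  shows "h (reflection_defect n b p q $ r $ s) = reflection_defect n (\<lambda>i j r. h (b i j r)) p q $ r $ s"
proof -
  note h1 = is_ring_hom_fps_hom[OF h]
  note h2 = is_ring_hom_fps_hom[OF h1]
  have "fps_hom (fps_hom h) (reflection_defect n b p q) = reflection_defect n (\<lambda>i j r. h (b i j r)) p q"
    unfolding reflection_defect_def Let_def
    by (simp add: is_ring_hom_simps[OF h2] tens_prod_hom[OF h2] tens_one_def tens_swap_def
        tens_at_def[abs_def] fps_hom_simps[OF h1] fps_hom_simps[OF h] is_ring_hom_simps[OF h1] cong: if_cong)
  then show ?thesis
    by (metis fps_hom_def fps_nth_Abs_fps)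
qed

lemma unitarity_defect_hom:
  assumes h: "is_ring_hom h"
  shows "h (unitarity_defect n b i j $ r) = unitarity_defect n (\<lambda>i j r. h (b i j r)) i j $ r"
proof -
  note h1 = is_ring_hom_fps_hom[OF h]
  have "fps_hom h (unitarity_defect n b i j) = unitarity_defect n (\<lambda>i j r. h (b i j r)) i j"
    unfolding unitarity_defect_def
    by (simp add: is_ring_hom_simps[OF h1] fps_hom_simps[OF h] is_ring_hom_simps[OF h])
  then show ?thesis
    by (metis fps_hom_def fps_nth_Abs_fps)
qed

lemma finite_multi_idx: "finite (multi_idx n k)"
  by (simp add: multi_idx_def finite_PiE)

lemma multi_idx_swap:
  assumes "p \<in> multi_idx n 2"
  shows "p \<circ> Transposition.transpose 1 2 \<in> multi_idx n 2"
proof -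
  have "Transposition.transpose (1::nat) 2 i \<in> {1..2} \<longleftrightarrow> i \<in> {1..2}" for i
    by (auto simp: Transposition.transpose_def)
  then show ?thesis
    using assms unfolding multi_idx_def PiE_iff extensional_def by auto
qed

text \<open>The numerical solution of the reflection equation.\<close>

definition sgn_diag :: "nat \<Rightarrow> nat \<Rightarrow> nat \<Rightarrow> nat \<Rightarrow> nat \<Rightarrow> complex" where
  "sgn_diag m n i j r =
    (if i = j \<and> r = 0 \<and> i \<in> {1..n} then if i \<le> m then 1 else - 1 else 0)"


definition diag_swap :: "nat \<Rightarrow> 'a::comm_ring_1 tens \<Rightarrow> ((nat \<Rightarrow> nat) \<Rightarrow> 'a) \<Rightarrow> ((nat \<Rightarrow> nat) \<Rightarrow> 'a) \<Rightarrow> bool" where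
  "diag_swap n X d e \<longleftrightarrow> (\<forall>p\<in>multi_idx n 2. \<forall>q\<in>multi_idx n 2. X p q =
    (if p = q then d p else 0) + (if p \<circ> Transposition.transpose 1 2 = q then e p else 0))"

lemma swap_swap: "p \<circ> Transposition.transpose (1::nat) 2 \<circ> Transposition.transpose 1 2 = p"
  by (simp add: comp_assoc)

lemma diag_swap_mult:
  assumes X: "diag_swap n X d e" and Y: "diag_swap n Y d' e'"
  shows "diag_swap n (tens_mult n 2 X Y)
    (\<lambda>p. d p * d' p + e p * e' (p \<circ> Transposition.transpose 1 2))
    (\<lambda>p. d p * e' p + e p * d' (p \<circ> Transposition.transpose 1 2))"
  unfolding diag_swap_def
proof (intro ballI)
  fix p q assume p: "p \<in> multi_idx n 2" and q: "q \<in> multi_idx n 2"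
  let ?t = "\<lambda>p :: nat \<Rightarrow> nat. p \<circ> Transposition.transpose 1 2"
  have tp: "?t p \<in> multi_idx n 2"
    by (rule multi_idx_swap[OF p])
  have "tens_mult n 2 X Y p q = (\<Sum>r\<in>multi_idx n 2.
      (if p = r then d p * Y r q else 0) + (if ?t p = r then e p * Y r q else 0))"
    unfolding tens_mult_def using X p
    by (intro sum.cong) (auto simp: diag_swap_def distrib_right)
  also have "\<dots> = d p * Y p q + e p * Y (?t p) q"
    using p tp by (simp add: sum.distrib finite_multi_idx)
  also have "\<dots> = (if p = q then d p * d' p + e p * e' (?t p) else 0) +
      (if ?t p = q then d p * e' p + e p * d' (?t p) else 0)"
    using Y p q tp swap_swap[of p] by (auto simp: diag_swap_def distrib_left)
  finally show "tens_mult n 2 X Y p q = \<dots>" .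
qed

lemma diag_swap_one: "diag_swap n tens_one (\<lambda>_. 1) (\<lambda>_. 0)"
  by (simp add: diag_swap_def tens_one_def)

lemma multi_idx_2_eq_iff:
  assumes "p \<in> multi_idx n 2" "q \<in> multi_idx n 2"
  shows "p = q \<longleftrightarrow> p 1 = q 1 \<and> p 2 = q 2"
proof -
  have "{1..2} = {1, 2::nat}" by auto
  then show ?thesis
    using assms unfolding multi_idx_def by (auto intro: PiE_ext)
qed

lemma swap_eq_iff: "p = q \<circ> Transposition.transpose (1::nat) 2 \<longleftrightarrow> p \<circ> Transposition.transpose 1 2 = q"
  using swap_swap by metis

lemma diag_swap_R:
  "diag_swap n (\<lambda>p q. c * tens_one p q - c' * tens_swap 1 2 p q) (\<lambda>_. c) (\<lambda>_. - c')"
  by (auto simp: diag_swap_def tens_one_def tens_swap_def swap_eq_iff)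

lemma diag_swap_at_1:
  assumes "\<And>i j. X i j = (if i = j then d i else 0)"
  shows "diag_swap n (tens_at 2 1 X) (\<lambda>p. d (p 1)) (\<lambda>_. 0)"
proof -
  have "{1..2} - {1} = {2::nat}" by auto
  then show ?thesis
    by (auto simp: diag_swap_def tens_at_def assms multi_idx_2_eq_iff)
qed

lemma diag_swap_at_2:
  assumes "\<And>i j. X i j = (if i = j then d i else 0)"
  shows "diag_swap n (tens_at 2 2 X) (\<lambda>p. d (p 2)) (\<lambda>_. 0)"
proof -
  have "{1..2} - {2} = {1::nat}" by auto
  then show ?thesis
    by (auto simp: diag_swap_def tens_at_def assms multi_idx_2_eq_iff)
qed

lemma reflection_defect_sgn_diag:
  assumes p: "p \<in> multi_idx n 2" and q: "q \<in> multi_idx n 2"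
  shows "reflection_defect n (sgn_diag m n) p q = 0"
proof -
  define D :: "nat \<Rightarrow> complex fps fps"
    where "D i = (if i \<in> {1..n} then if i \<le> m then 1 else - 1 else 0)" for i
  have 1: "Abs_fps (\<lambda>r. fps_const (sgn_diag m n i j r)) = (if i = j then D i else 0)"
    and 2: "fps_const (Abs_fps (sgn_diag m n i j)) = (if i = j then D i else 0)" for i j
    by (auto simp: fps_eq_iff sgn_diag_def D_def)
  have p12: "p 1 \<in> {1..n}" "p 2 \<in> {1..n}"
    using p by (auto simp: multi_idx_def PiE_def Pi_def)
  have D1: "D (p 1) = 1 \<or> D (p 1) = - 1" and D2: "D (p 2) = 1 \<or> D (p 2) = - 1"
    using p12 by (auto simp: D_def)
  note at = diag_swap_at_1[of _ D n, OF 1] diag_swap_at_2[of _ D n, OF 2]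
  note left = diag_swap_mult[OF diag_swap_R diag_swap_mult[OF at(1) diag_swap_mult[OF diag_swap_R
        diag_swap_mult[OF at(2) diag_swap_one]]]]
  note right = diag_swap_mult[OF at(2) diag_swap_mult[OF diag_swap_R diag_swap_mult[OF at(1)
        diag_swap_mult[OF diag_swap_R diag_swap_one]]]]
  have t: "Transposition.transpose 1 2 (1::nat) = 2" "Transposition.transpose 1 2 (2::nat) = 1"
    by simp_all
  show ?thesis
    unfolding reflection_defect_def Let_def tens_prod_def foldr.simps comp_apply id_apply
      left[unfolded diag_swap_def, rule_format, OF p q]
      right[unfolded diag_swap_def, rule_format, OF p q]
    using D1 D2 by (auto simp: t algebra_simps simp del: One_nat_def)
qed

lemma unitarity_defect_sgn_diag:
  assumes "i \<in> {1..n}"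
  shows "unitarity_defect n (sgn_diag m n) i j = 0"
proof -
  define D :: "nat \<Rightarrow> complex fps"
    where "D i = (if i \<in> {1..n} then if i \<le> m then 1 else - 1 else 0)" for i
  have "Abs_fps (sgn_diag m n i k) = (if i = k then D i else 0)"
    "Abs_fps (\<lambda>r. (- 1) ^ r * sgn_diag m n k j r) = (if k = j then D k else 0)" for k
    by (auto simp: fps_eq_iff sgn_diag_def D_def)
  then have "unitarity_defect n (sgn_diag m n) i j =
      (\<Sum>k\<in>{1..n}. if i = k then (if i = j then D i * D i else 0) else 0) - (if i = j then 1 else 0)"
    unfolding unitarity_defect_def by (intro arg_cong2[where f = minus] sum.cong) auto
  then show ?thesis
    using assms by (simp add: D_def)
qed

lemma one_notin_reflection_ideal:
  "1 \<notin> two_sided_ideal (reflection_relators m l)"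
proof
  let ?n = "m + l"
  define g where "g = (\<lambda>(i, j, r). sgn_diag m ?n i j r)"
  have hom: "is_ring_hom (free_eval g)"
    by (simp add: is_ring_hom_def free_eval_one free_eval_add free_eval_mult)
  have gen: "free_eval g (free_gen (i, j, r)) = sgn_diag m ?n i j r" for i j r
    by (simp add: free_eval_single g_def)
  have sgn_not_in: "sgn_diag m ?n i j r = 0" if "\<not> (i \<in> {1..?n} \<and> j \<in> {1..?n})" for i j r
    unfolding sgn_diag_def using that by (intro if_not_P) blast
  have scal: "free_eval g (free_scalar c) = c" for c
    by (simp add: free_eval_single zero_word_def)
  have rel: "free_eval g s = 0" if "s \<in> reflection_relators m l" for s
    using that unfolding reflection_relators_def Let_def
  proof (elim UnE CollectE exE conjE)
    fix i j r
    assume s: "s = free_gen (i, j, r)" and ij: "\<not> (i \<in> {1..?n} \<and> j \<in> {1..?n})"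
    show ?thesis
      unfolding s gen by (rule sgn_not_in[OF ij])
  next
    fix i j
    assume s: "s = free_gen (i, j, 0) - free_scalar (if i = j then if i \<le> m then 1 else - 1 else 0)"
      and i: "i \<in> {1..?n}"
    show ?thesis
      unfolding s is_ring_hom_simps(6)[OF hom] gen scal using i by (simp add: sgn_diag_def)
  next
    fix p q r t
    assume s: "s = reflection_defect ?n (\<lambda>i j r. free_gen (i, j, r)) p q $ r $ t"
      and pq: "p \<in> multi_idx ?n 2" "q \<in> multi_idx ?n 2"
    show ?thesis
      unfolding s reflection_defect_hom[OF hom] gen reflection_defect_sgn_diag[OF pq] by simp
  next
    fix i j r
    assume s: "s = unitarity_defect ?n (\<lambda>i j r. free_gen (i, j, r)) i j $ r"
      and i: "i \<in> {1..?n}"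
    show ?thesis
      unfolding s unitarity_defect_hom[OF hom] gen unitarity_defect_sgn_diag[OF i] by simp
  qed
  have ideal: "free_eval g x = 0" if "x \<in> two_sided_ideal (reflection_relators m l)" for x
    using that
  proof induction
    case (gen s a b)
    show ?case
      using rel[OF gen] by (simp add: free_eval_mult)
  qed (simp_all add: free_eval_zero free_eval_add)
  assume "1 \<in> two_sided_ideal (reflection_relators m l)"
  from ideal[OF this] show False
    unfolding free_eval_one by simp
qed


subsection \<open>The quotient\<close>

text \<open>
  \<open>('m, 'l) reflection_algebra\<close> is \<open>\<B>(n, l)\<close> for \<open>n = m + l\<close>, \<open>m = LENGTH('m)\<close> and
  \<open>l = LENGTH('l)\<close>. Every natural number, 0 included, is the length of some type of class
  \<open>len0\<close>.
\<close>

quotient_type (overloaded) ('m, 'l) reflection_algebra = "refl_gen free_algebra" /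
  "\<lambda>x y. x - y \<in> two_sided_ideal (reflection_relators LENGTH('m::len0) LENGTH('l::len0))"
  by (rule equivp_two_sided_ideal)

instantiation reflection_algebra :: (len0, len0) ring_1
begin

lift_definition zero_reflection_algebra :: "('a, 'b) reflection_algebra" is 0 .

lift_definition one_reflection_algebra :: "('a, 'b) reflection_algebra" is 1 .

lift_definition plus_reflection_algebra ::
  "('a, 'b) reflection_algebra \<Rightarrow> ('a, 'b) reflection_algebra \<Rightarrow> ('a, 'b) reflection_algebra"
  is "(+)"
  by (rule two_sided_ideal_cong_add)

lift_definition uminus_reflection_algebra ::
  "('a, 'b) reflection_algebra \<Rightarrow> ('a, 'b) reflection_algebra"
  is uminus
  by (rule two_sided_ideal_cong_uminus)

lift_definition minus_reflection_algebra ::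
  "('a, 'b) reflection_algebra \<Rightarrow> ('a, 'b) reflection_algebra \<Rightarrow> ('a, 'b) reflection_algebra"
  is "(-)"
  by (rule two_sided_ideal_cong_diff)

lift_definition times_reflection_algebra ::
  "('a, 'b) reflection_algebra \<Rightarrow> ('a, 'b) reflection_algebra \<Rightarrow> ('a, 'b) reflection_algebra"
  is "(*)"
  by (rule two_sided_ideal_cong_mult)

instance
proof
  show "(0 :: ('a, 'b) reflection_algebra) \<noteq> 1"
  proof (transfer, rule notI)
    assume "0 - 1 \<in> two_sided_ideal (reflection_relators LENGTH('a) LENGTH('b))"
    from two_sided_ideal_uminus[OF this] show False
      using one_notin_reflection_ideal by simp
  qed
qed (transfer, simp add: algebra_simps two_sided_ideal.zero)+

end

text \<open>The structure of an algebra over \<open>\<complex>\<close> is given by the central embedding of the scalars.\<close>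

lift_definition scalar :: "complex \<Rightarrow> ('m::len0, 'l::len0) reflection_algebra" is free_scalar .

lemma scalar_hom:
  "scalar 0 = 0" "scalar 1 = 1" "scalar (c + d) = scalar c + scalar d"
  "scalar (c * d) = scalar c * scalar d"
  by (transfer; simp add: single_add mult_single two_sided_ideal.zero)+

lemma scalar_central:
  "scalar c * a = a * scalar c" for a :: "('m::len0, 'l::len0) reflection_algebra"
proof transfer
  fix c and a :: "refl_gen free_algebra"
  have "free_scalar c * a = (\<Sum>w\<in>Poly_Mapping.keys a. free_scalar c * Poly_Mapping.single w (Poly_Mapping.lookup a w))"
    unfolding sum_distrib_left[symmetric] by (intro arg_cong2[where f = times] poly_mapping_eq_sum_single refl)
  also have "\<dots> = (\<Sum>w\<in>Poly_Mapping.keys a. Poly_Mapping.single w (Poly_Mapping.lookup a w) * free_scalar c)"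
    by (simp add: mult_single mult.commute)
  also have "\<dots> = a * free_scalar c"
    unfolding sum_distrib_right[symmetric]
    by (intro arg_cong2[where f = times] poly_mapping_eq_sum_single[symmetric] refl)
  finally show "free_scalar c * a - a * free_scalar c
      \<in> two_sided_ideal (reflection_relators LENGTH('m) LENGTH('l))"
    by (simp add: two_sided_ideal.zero)
qed

lift_definition b_gen :: "nat \<Rightarrow> nat \<Rightarrow> nat \<Rightarrow> ('m::len0, 'l::len0) reflection_algebra"
  is "\<lambda>i j r. free_gen (i, j, r)" .


section \<open>The Sklyanin determinant\<close>

text \<open>From here on the variable of all power series is \<open>u\<^sup>-\<^sup>1\<close>.\<close>

definition scalar_fps :: "complex fps \<Rightarrow> ('m::len0, 'l::len0) reflection_algebra fps" where
  "scalar_fps f = Abs_fps (\<lambda>k. scalar (f $ k))"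

text \<open>The expansion of \<open>1/(a u + c) = u\<^sup>-\<^sup>1/(a + c u\<^sup>-\<^sup>1)\<close>, for \<open>a \<noteq> 0\<close>.\<close>

definition inv_linear :: "complex \<Rightarrow> complex \<Rightarrow> complex fps" where
  "inv_linear a c = fps_X * inverse (fps_const a + fps_const c * fps_X)"

text \<open>
  \<open>b_shift c i j\<close> is \<open>b\<^sub>i\<^sup>j(u - c)\<close>, with lower index \<open>i\<close> and upper index \<open>j\<close>: the series
  \<open>1/(u - c)\<close> is substituted for \<open>u\<^sup>-\<^sup>1\<close>.
\<close>

definition b_shift :: "nat \<Rightarrow> nat \<Rightarrow> nat \<Rightarrow> ('m::len0, 'l::len0) reflection_algebra fps" where
  "b_shift c i j = Abs_fps (b_gen i j) oo scalar_fps (inv_linear 1 (- of_nat c))"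

text \<open>\<open>R\<^bsub>ij\<^esub>(2u - i - j + 2)\<close>\<close>

definition R_op :: "nat \<Rightarrow> nat \<Rightarrow> ('m::len0, 'l::len0) reflection_algebra fps tens" where
  "R_op i j p q = tens_one p q -
     scalar_fps (inv_linear 2 (2 - of_nat i - of_nat j)) * tens_swap i j p q"

definition bracket :: "nat \<Rightarrow> ('m::len0, 'l::len0) reflection_algebra fps tens" where
  "bracket n = tens_prod n n
     (concat (map (\<lambda>i. tens_at n i (b_shift (i - 1)) # map (R_op i) [i + 1..<n + 1]) [1..<n + 1]))"

definition sdet :: "('m::len0, 'l::len0) reflection_algebra fps" where
  "sdet = (let n = LENGTH('m) + LENGTH('l) in
     THE s. \<forall>p\<in>multi_idx n n. \<forall>q\<in>multi_idx n n.
       tens_mult n n (antisymmetrizer n) (bracket n) p q = s * antisymmetrizer n p q)"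


section \<open>Combinatorial data\<close>

definition index_maps :: "nat \<Rightarrow> (nat \<Rightarrow> nat) set" where
  "index_maps n = (\<Pi>\<^sub>E i\<in>{1..n}. {i..n})"

definition fibre :: "nat \<Rightarrow> (nat \<Rightarrow> nat) \<Rightarrow> nat \<Rightarrow> nat set" where
  "fibre n \<eta> N = {k \<in> {1..n}. \<eta> k = N}"

text \<open>The product of the (disjoint, hence commuting) cycles \<open>\<Gamma>\<^sub>j\<close>.\<close>

definition cycle_perm :: "nat \<Rightarrow> (nat \<Rightarrow> nat) \<Rightarrow> nat \<Rightarrow> nat" where
  "cycle_perm n \<eta> =
     foldr (\<lambda>N \<pi>. cycle_of_list (sorted_list_of_set (fibre n \<eta> N)) \<circ> \<pi>)
       (sorted_list_of_set (\<eta> ` {1..n})) id"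

definition cycle_minima :: "nat \<Rightarrow> (nat \<Rightarrow> nat) \<Rightarrow> nat set" where
  "cycle_minima n \<eta> = (\<lambda>N. Min (fibre n \<eta> N)) ` \<eta> ` {1..n}"

definition cycle_maxima :: "nat \<Rightarrow> (nat \<Rightarrow> nat) \<Rightarrow> nat set" where
  "cycle_maxima n \<eta> = (\<lambda>N. Max (fibre n \<eta> N)) ` \<eta> ` {1..n}"

definition image_perms :: "nat \<Rightarrow> (nat \<Rightarrow> nat) \<Rightarrow> (nat \<Rightarrow> nat) set" where
  "image_perms n \<eta> = {\<sigma>. \<sigma> permutes {1..n} \<and> (\<forall>i\<in>{1..n} - \<eta> ` {1..n}. \<sigma> i = i)}"

text \<open>The coefficient of \<open>E\<^bsub>p(1)q(1)\<^esub> \<otimes> \<dots> \<otimes> E\<^bsub>p(n)q(n)\<^esub>\<close> in the product of the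
  \<open>B\<^bsub>\<eta>(k)\<^esub>(u - k + 1)\<close>.\<close>

definition b_coeff ::
    "nat \<Rightarrow> (nat \<Rightarrow> nat) \<Rightarrow> ('m::len0, 'l::len0) reflection_algebra fps tens" where
  "b_coeff n \<eta> = tens_prod n n (map (\<lambda>k. tens_at n (\<eta> k) (b_shift (k - 1))) [1..<n + 1])"

definition sdet_weight :: "nat \<Rightarrow> (nat \<Rightarrow> nat) \<Rightarrow> (nat \<Rightarrow> nat) \<Rightarrow> complex fps" where
  "sdet_weight n \<sigma> \<eta> = of_int (sign \<sigma>) *
     (\<Prod>i | i \<in> {1..n} \<and> i < \<eta> i. inv_linear 2 (2 - of_nat i - of_nat n))"

definition lower_idx :: "nat \<Rightarrow> (nat \<Rightarrow> nat) \<Rightarrow> (nat \<Rightarrow> nat) \<Rightarrow> (nat \<Rightarrow> nat) \<Rightarrow> nat \<Rightarrow> nat" where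
  "lower_idx n \<eta> \<sigma> s k = (if k \<in> cycle_minima n \<eta> then \<sigma> (\<eta> k) else s k)"

definition upper_idx :: "nat \<Rightarrow> (nat \<Rightarrow> nat) \<Rightarrow> (nat \<Rightarrow> nat) \<Rightarrow> nat \<Rightarrow> nat" where
  "upper_idx n \<eta> s k = (if k \<in> cycle_maxima n \<eta> then \<eta> k else s (cycle_perm n \<eta> k))"

text \<open>The values of the summation indices \<open>s\<^sub>t\<close>: those occurring have \<open>t\<close> outside the minima of
  the cycles, and each of them occurs exactly twice.\<close>

definition summation_idx :: "nat \<Rightarrow> (nat \<Rightarrow> nat) \<Rightarrow> (nat \<Rightarrow> nat) set" where
  "summation_idx n \<eta> = ({1..n} - cycle_minima n \<eta>) \<rightarrow>\<^sub>E {1..n}"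

end

theory Submission
  imports Defs
begin

text \<open>
  Operators on the tensor power act from the right on row vectors, and the whole argument
  concerns the row \<open>\<epsilon>\<close> of the antisymmetrizer with index \<open>(1, \<dots>, n)\<close>.

  Existence of \<open>sdet\<close>: since \<open>R\<^bsub>i,i+1\<^esub>(1) = 1 - P\<close>, the reflection equation at \<open>u - i + 1\<close> and
  \<open>u - i\<close> and the Yang--Baxter relation show that every factor of \<open>\<langle>B\<^sub>1, \<dots>, B\<^sub>n\<rangle>\<close>, or a product of
  two of them, preserves the vectors that change sign under the swap of \<open>i\<close> and \<open>i + 1\<close>. Thus
  \<open>\<epsilon> \<langle>B\<^sub>1, \<dots>, B\<^sub>n\<rangle>\<close> is alternating, i.e. a multiple of \<open>\<epsilon>\<close>, and \<open>sdet\<close> is its entry at \<open>(1, \<dots>, n)\<close>.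

  The sum over \<open>\<eta>\<close>: on vectors alternating in the positions \<open>i, \<dots>, n\<close> the block
  \<open>B\<^sub>i R\<^bsub>i,i+1\<^esub> \<dots> R\<^bsub>i,n\<^esub>\<close> telescopes to \<open>Z\<^sub>i = B\<^sub>i + (B\<^bsub>i+1\<^esub> + \<dots> + B\<^sub>n) / (2u + 2 - i - n)\<close>, which
  preserves alternation in \<open>i + 1, \<dots>, n\<close>. Hence \<open>\<epsilon> \<langle>B\<^sub>1, \<dots>, B\<^sub>n\<rangle> = \<epsilon> Z\<^sub>1 \<dots> Z\<^sub>n\<close>; expanding the
  product gives one summand for each choice \<open>\<eta>\<^sub>i \<ge> i\<close>.
\<close>

declare One_nat_def [simp del]

section \<open>Row vectors and alternation\<close>

text \<open>
  The operators below are the right actions of \<open>X\<^sub>i\<close> and \<open>1 - c P\<^bsub>ij\<^esub>\<close> on row vectors, extended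
  to all index functions so that identities between them need no side conditions on the index.
\<close>

definition row_at :: "nat \<Rightarrow> nat \<Rightarrow> (nat \<Rightarrow> nat \<Rightarrow> 'r::ring_1) \<Rightarrow> ((nat \<Rightarrow> nat) \<Rightarrow> 'r) \<Rightarrow> (nat \<Rightarrow> nat) \<Rightarrow> 'r" where
  "row_at n i X f q = (\<Sum>t\<in>{1..n}. f (q(i := t)) * X t (q i))"

definition row_R :: "'r::ring_1 \<Rightarrow> nat \<Rightarrow> nat \<Rightarrow> ((nat \<Rightarrow> nat) \<Rightarrow> 'r) \<Rightarrow> (nat \<Rightarrow> nat) \<Rightarrow> 'r" where
  "row_R c i j f q = f q - c * f (q \<circ> Transposition.transpose i j)"

text \<open>The condition ranges over \<open>multi_idx\<close> only, because the reflection equation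
  gives information about these indices and no others.\<close>

definition alternating :: "nat \<Rightarrow> nat \<Rightarrow> nat \<Rightarrow> nat \<Rightarrow> ((nat \<Rightarrow> nat) \<Rightarrow> 'r::ring_1) \<Rightarrow> bool" where
  "alternating n k i j f \<longleftrightarrow> (\<forall>q\<in>multi_idx n k. f (q \<circ> Transposition.transpose i j) = - f q)"

lemma multi_idx_upd:
  assumes "q \<in> multi_idx n k" "i \<in> {1..k}" "t \<in> {1..n}"
  shows "q(i := t) \<in> multi_idx n k"
  using assms unfolding multi_idx_def PiE_iff extensional_def by auto

lemma multi_idx_transpose:
  assumes "q \<in> multi_idx n k" "i \<in> {1..k}" "j \<in> {1..k}"
  shows "q \<circ> Transposition.transpose i j \<in> multi_idx n k"
proof -
  have "Transposition.transpose i j x \<in> {1..k} \<longleftrightarrow> x \<in> {1..k}" for x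
    using assms(2,3) by (auto simp: Transposition.transpose_def)
  then show ?thesis
    using assms(1) unfolding multi_idx_def PiE_iff extensional_def by auto
qed

lemma multi_idx_apply: "q \<in> multi_idx n k \<Longrightarrow> i \<in> {1..k} \<Longrightarrow> q i \<in> {1..n}"
  unfolding multi_idx_def by auto

lemma row_at_cong:
  assumes "\<And>q. q \<in> multi_idx n k \<Longrightarrow> f q = g q" "i \<in> {1..k}" "q \<in> multi_idx n k"
  shows "row_at n i X f q = row_at n i X g q"
  unfolding row_at_def using assms multi_idx_upd by (intro sum.cong) auto

lemma row_R_cong:
  assumes "\<And>q. q \<in> multi_idx n k \<Longrightarrow> f q = g q" "i \<in> {1..k}" "j \<in> {1..k}" "q \<in> multi_idx n k"
  shows "row_R c i j f q = row_R c i j g q"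
  unfolding row_R_def using assms multi_idx_transpose by metis

lemma alternatingD:
  "alternating n k i j f \<Longrightarrow> q \<in> multi_idx n k \<Longrightarrow> f (q \<circ> Transposition.transpose i j) = - f q"
  by (simp add: alternating_def)

lemma upd_comp_transpose:
  "(q \<circ> Transposition.transpose i j)(l := t) =
    q(Transposition.transpose i j l := t) \<circ> Transposition.transpose i j"
proof
  fix x
  show "((q \<circ> Transposition.transpose i j)(l := t)) x =
    (q(Transposition.transpose i j l := t) \<circ> Transposition.transpose i j) x"
    by (cases "x = l") (auto simp: transpose_eq_iff)
qed

text \<open>Conjugation by \<open>P\<close> on the legs \<open>i\<close> and \<open>j\<close> moves
  a matrix from position \<open>l\<close> to the transposed position; the sign comes from the
  alternation of \<open>f\<close>.\<close>

lemma row_at_transpose: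
  assumes f: "alternating n k i j f" and ij: "i \<in> {1..k}" "j \<in> {1..k}" "l \<in> {1..k}"
    and q: "q \<in> multi_idx n k"
  shows "row_at n l X f (q \<circ> Transposition.transpose i j) =
    - row_at n (Transposition.transpose i j l) X f q"
proof -
  have l: "Transposition.transpose i j l \<in> {1..k}"
    using ij by (auto simp: Transposition.transpose_def)
  show ?thesis
    unfolding row_at_def upd_comp_transpose sum_negf[symmetric]
    using multi_idx_upd[OF q l] by (intro sum.cong) (simp_all add: alternatingD[OF f])
qed

lemma alternating_row_at:
  assumes "alternating n k i j f" "i \<in> {1..k}" "j \<in> {1..k}" "l \<in> {1..k}" "l \<noteq> i" "l \<noteq> j"
  shows "alternating n k i j (row_at n l X f)"
  using row_at_transpose[OF assms(1-4)] assms(5,6) by (simp add: alternating_def)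

lemma transpose_commute_disjoint:
  "a \<noteq> i \<Longrightarrow> a \<noteq> j \<Longrightarrow> b \<noteq> i \<Longrightarrow> b \<noteq> j \<Longrightarrow>
    q \<circ> Transposition.transpose i j \<circ> Transposition.transpose a b =
    q \<circ> Transposition.transpose a b \<circ> Transposition.transpose i j"
  by (auto simp: fun_eq_iff Transposition.transpose_def)

text \<open>These forms turn a product of two overlapping swaps into one that ends in a swap under
  which the row vector changes sign.\<close>

lemma transpose_braid:
  assumes "i \<noteq> j" "i \<noteq> k" "j \<noteq> k"
  shows "q \<circ> Transposition.transpose i j \<circ> Transposition.transpose i k =
      q \<circ> Transposition.transpose i k \<circ> Transposition.transpose j k"
    "q \<circ> Transposition.transpose i j \<circ> Transposition.transpose i k =
      q \<circ> Transposition.transpose j k \<circ> Transposition.transpose i j"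
  using assms by (auto simp: fun_eq_iff Transposition.transpose_def)

lemma alternating_row_R:
  assumes "alternating n k i j f" "i \<in> {1..k}" "j \<in> {1..k}" "a \<in> {1..k}" "b \<in> {1..k}"
    "a \<noteq> i" "a \<noteq> j" "b \<noteq> i" "b \<noteq> j"
  shows "alternating n k i j (row_R c a b f)"
  unfolding alternating_def row_R_def
proof
  fix q assume q: "q \<in> multi_idx n k"
  show "f (q \<circ> Transposition.transpose i j) - c * f (q \<circ> Transposition.transpose i j \<circ> Transposition.transpose a b) =
      - (f q - c * f (q \<circ> Transposition.transpose a b))"
    unfolding transpose_commute_disjoint[OF assms(6-9)] alternatingD[OF assms(1) q]
      alternatingD[OF assms(1) multi_idx_transpose[OF q assms(4,5)]]
    by simp
qed

text \<open>The product of the two swaps reduces by the braid relation and alternation to minus a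
  single swap. The condition \<open>c + d * c = d\<close> then gives both remaining swaps the same
  coefficient.\<close>

lemma row_R_row_R:
  assumes f: "alternating n k i j f" and q: "q \<in> multi_idx n k"
    and ij: "i \<in> {1..k}" "j \<in> {1..k}" "l \<in> {1..k}" "i \<noteq> j" "l \<noteq> i" "l \<noteq> j"
    and cd: "c + d * c = d"
  shows "row_R d l j (row_R c l i f) q =
    f q - d * (f (q \<circ> Transposition.transpose l i) + f (q \<circ> Transposition.transpose l j))"
proof -
  have "f (q \<circ> Transposition.transpose l j \<circ> Transposition.transpose l i) =
      f (q \<circ> Transposition.transpose l i \<circ> Transposition.transpose i j)"
    using transpose_braid(1)[of l j i q] ij by (simp add: transpose_commute)
  also have "\<dots> = - f (q \<circ> Transposition.transpose l i)"
    by (intro alternatingD[OF f] multi_idx_transpose q ij)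
  finally have "row_R d l j (row_R c l i f) q =
     f q - (c + d * c) * f (q \<circ> Transposition.transpose l i) - d * f (q \<circ> Transposition.transpose l j)"
    unfolding row_R_def by (simp add: algebra_simps)
  then show ?thesis
    unfolding cd by (simp add: algebra_simps)
qed

text \<open>The expression in \<open>row_R_row_R\<close> is symmetric in \<open>i\<close> and
  \<open>j\<close>, and the swap of these positions interchanges its two swap terms up to sign. This
  plays the part of the Yang-Baxter relation with a factor 1 - P on the legs \<open>i\<close> and
  \<open>j\<close>.\<close>

lemma alternating_row_R_row_R:
  assumes f: "alternating n k i j f"
    and ij: "i \<in> {1..k}" "j \<in> {1..k}" "l \<in> {1..k}" "i \<noteq> j" "l \<noteq> i" "l \<noteq> j"
    and cd: "c + d * c = d"
  shows "alternating n k i j (row_R d l j (row_R c l i f))"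
  unfolding alternating_def
proof
  fix q assume q: "q \<in> multi_idx n k"
  have "f (q \<circ> Transposition.transpose i j \<circ> Transposition.transpose l i) =
      f (q \<circ> Transposition.transpose l j \<circ> Transposition.transpose i j)"
    using transpose_braid(2)[of i j l q] transpose_braid(1)[of i j l q] ij by (simp add: transpose_commute)
  moreover have "f (q \<circ> Transposition.transpose i j \<circ> Transposition.transpose l j) =
      f (q \<circ> Transposition.transpose l i \<circ> Transposition.transpose i j)"
    using transpose_braid(2)[of j i l q] transpose_braid(1)[of j i l q] ij by (simp add: transpose_commute)
  ultimately show "row_R d l j (row_R c l i f) (q \<circ> Transposition.transpose i j) = - row_R d l j (row_R c l i f) q"
    unfolding row_R_row_R[OF f q ij cd] row_R_row_R[OF f multi_idx_transpose[OF q ij(1,2)] ij cd]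
    using multi_idx_transpose[OF q] ij
    by (simp add: alternatingD[OF f] q algebra_simps del: comp_apply)
qed

text \<open>The coefficient \<open>c\<close> multiplies from the left and the entries of
  \<open>X\<close> from the right, so associativity suffices and \<open>c\<close> may be
  arbitrary.\<close>

lemma row_at_row_R_commute:
  assumes "l \<noteq> i" "l \<noteq> j"
  shows "row_at n l X (row_R c i j f) = row_R c i j (row_at n l X f)"
proof -
  have "q(l := t) \<circ> Transposition.transpose i j = (q \<circ> Transposition.transpose i j)(l := t)" for q and t :: nat
    unfolding upd_comp_transpose using assms by simp
  moreover have "(q \<circ> Transposition.transpose i j) l = q l" for q :: "nat \<Rightarrow> nat"
    using assms by simp
  ultimately show ?thesis
    unfolding row_at_def row_R_def
    by (intro ext) (simp add: left_diff_distrib sum_subtractf sum_distrib_left mult.assoc del: comp_apply)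
qed

lemma row_R_commute:
  assumes "a \<noteq> i" "a \<noteq> j" "b \<noteq> i" "b \<noteq> j" "c * d = d * c"
  shows "row_R c i j (row_R d a b f) = row_R d a b (row_R c i j f)"
proof
  fix q
  have "c * (d * x) = d * (c * x)" for x
    using assms(5) by (metis mult.assoc)
  then show "row_R c i j (row_R d a b f) q = row_R d a b (row_R c i j f) q"
    unfolding row_R_def transpose_commute_disjoint[OF assms(1-4)]
    by (simp add: algebra_simps)
qed

lemma row_at_scale:
  assumes "\<And>q. q \<in> multi_idx n k \<Longrightarrow> f q = c * g q" "i \<in> {1..k}" "q \<in> multi_idx n k"
  shows "row_at n i X f q = c * row_at n i X g q"
  using assms multi_idx_upd[OF assms(3,2)] unfolding row_at_def
  by (simp add: sum_distrib_left mult.assoc)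

lemma row_R_scale:
  assumes "\<And>q. q \<in> multi_idx n k \<Longrightarrow> f q = c * g q" "i \<in> {1..k}" "j \<in> {1..k}" "q \<in> multi_idx n k" "c * d = d * c"
  shows "row_R d i j f q = c * row_R d i j g q"
proof -
  have "d * (c * x) = c * (d * x)" for x
    using assms(5) by (metis mult.assoc)
  then show ?thesis
    using assms(1)[OF assms(4)] assms(1)[OF multi_idx_transpose[OF assms(4,2,3)]]
    unfolding row_R_def by (simp add: algebra_simps)
qed

text \<open>On an alternating \<open>f\<close> the operator 1 - P is multiplication by 2, so the
  left side of the reflection equation is twice the vector in question. The right side ends in 1 - P
  and therefore changes sign under the swap. Cancelling 2 gives the claim.\<close>

lemma alternating_reflection:
  fixes f :: "(nat \<Rightarrow> nat) \<Rightarrow> 'r::ring_1"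
  assumes f: "alternating n k i j f" and ij: "i \<in> {1..k}" "j \<in> {1..k}"
    and two: "\<And>x::'r. 2 * x = 0 \<Longrightarrow> x = 0"
    and refl: "\<And>q. q \<in> multi_idx n k \<Longrightarrow>
      row_at n j Y (row_R c i j (row_at n i X (row_R 1 i j f))) q =
      row_R 1 i j (row_at n i X (row_R c i j (row_at n j Y f))) q"
  shows "alternating n k i j (row_at n j Y (row_R c i j (row_at n i X f)))"
    (is "alternating n k i j ?G")
proof -
  define H where "H = row_at n i X (row_R c i j (row_at n j Y f))"
  have "row_at n j Y (row_R c i j (row_at n i X (row_R 1 i j f))) q = 2 * ?G q"
    if q: "q \<in> multi_idx n k" for q
    using ij q f
    by (intro row_at_scale[where k = k] row_R_scale[where k = k]) 
       (auto simp: row_R_def alternatingD[OF f] mult_2 mult_2_right)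
  then have 2: "2 * ?G q = H q - H (q \<circ> Transposition.transpose i j)" if "q \<in> multi_idx n k" for q
    using refl that unfolding H_def row_R_def by simp
  show ?thesis
    unfolding alternating_def
  proof
    fix q assume q: "q \<in> multi_idx n k"
    have "2 * (?G (q \<circ> Transposition.transpose i j) + ?G q) = 0"
      unfolding distrib_left 2[OF q] 2[OF multi_idx_transpose[OF q ij]]
      by (simp add: comp_assoc)
    from two[OF this] show "?G (q \<circ> Transposition.transpose i j) = - ?G q"
      by (simp add: eq_neg_iff_add_eq_0)
  qed
qed

section \<open>Vectors alternating in all positions\<close>

lemma alternating_commute: "alternating n k i j f \<longleftrightarrow> alternating n k j i f"
  by (simp add: alternating_def transpose_commute)

lemma multi_idx_self: "restrict id {1..n} \<in> multi_idx n n"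
  by (auto simp: multi_idx_def)

text \<open>Induction on \<open>j\<close>: the transposition of \<open>i\<close> and
  \<open>Suc j\<close> is that of \<open>i\<close> and \<open>j\<close> conjugated by an adjacent
  one, and three sign changes amount to one.\<close>

lemma alternating_all_pairs:
  assumes adj: "\<And>i. i \<in> {1..<k} \<Longrightarrow> alternating n k i (Suc i) f"
    and i: "1 \<le> i" and "i < j" "j \<le> k"
  shows "alternating n k i j f"
  using assms(3,4)
proof (induction j)
  case (Suc j)
  show ?case
  proof (cases "i = j")
    case True
    then show ?thesis using adj[of i] Suc i by simp
  next
    case False
    then have a: "alternating n k i j f" and b: "alternating n k j (Suc j) f"
      using Suc adj[of j] i by auto
    have r: "i \<in> {1..k}" "j \<in> {1..k}" "Suc j \<in> {1..k}"
      using Suc.prems i by auto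
    have t: "q \<circ> Transposition.transpose i (Suc j) =
      q \<circ> Transposition.transpose j (Suc j) \<circ> Transposition.transpose i j \<circ> Transposition.transpose j (Suc j)" for q
      using Suc.prems False by (auto simp: fun_eq_iff Transposition.transpose_def)
    show ?thesis
      unfolding alternating_def t using r
      by (auto simp del: comp_apply simp: alternatingD[OF a] alternatingD[OF b] multi_idx_transpose)
  qed
qed simp

text \<open>If \<open>q\<close> has a repeated entry, some swap fixes it and
  \<open>f q = - f q\<close>. Otherwise \<open>q\<close> is a permutation, and transpositions lead
  to it from the identity, where \<open>f\<close> vanishes.\<close>

lemma alternating_eq_zero:
  fixes f :: "(nat \<Rightarrow> nat) \<Rightarrow> 'r::ring_1"
  assumes alt: "\<And>i. i \<in> {1..<n} \<Longrightarrow> alternating n n i (Suc i) f"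
    and two: "\<And>x::'r. 2 * x = 0 \<Longrightarrow> x = 0"
    and id: "f (restrict id {1..n}) = 0" and q: "q \<in> multi_idx n n"
  shows "f q = 0"
proof -
  have all: "alternating n n i j f" if "i \<in> {1..n}" "j \<in> {1..n}" "i \<noteq> j" for i j
  proof (cases "i < j")
    case True
    then show ?thesis using that alternating_all_pairs[OF alt, of i j] by simp
  next
    case False
    then have "alternating n n j i f"
      using that alternating_all_pairs[OF alt, of j i] by simp
    then show ?thesis by (subst alternating_commute)
  qed
  show ?thesis
  proof (cases "inj_on q {1..n}")
    case False
    then obtain i j where ij: "i \<in> {1..n}" "j \<in> {1..n}" "i \<noteq> j" "q i = q j"
      by (auto simp: inj_on_def)
    have "q \<circ> Transposition.transpose i j = q"
      using ij by (auto simp: fun_eq_iff Transposition.transpose_def)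
    then have "f q = - f q"
      using alternatingD[OF all[OF ij(1-3)] q] by simp
    then have "2 * f q = 0"
      by (simp add: mult_2 eq_neg_iff_add_eq_0)
    then show ?thesis by (rule two)
  next
    case True
    \<comment> \<open>\<open>q\<close> is undefined outside \<open>{1..n}\<close>. Completing it by
      the identity gives a genuine permutation, to which induction over transpositions
      applies.\<close>
    define \<pi> where "\<pi> x = (if x \<in> {1..n} then q x else x)" for x
    have im: "q ` {1..n} \<subseteq> {1..n}"
      by (intro image_subsetI multi_idx_apply[OF q])
    have "bij_betw \<pi> {1..n} {1..n}"
    proof (rule bij_betw_imageI)
      show "inj_on \<pi> {1..n}" using True inj_on_cong[of "{1..n}" \<pi> q] by (simp add: \<pi>_def)
      have "q ` {1..n} = {1..n}" using True im by (intro endo_inj_surj) auto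
      then show "\<pi> ` {1..n} = {1..n}" by (simp add: \<pi>_def)
    qed
    then have \<pi>: "\<pi> permutes {1..n}"
      by (rule bij_imp_permutes) (auto simp: \<pi>_def)
    have "f (restrict id {1..n} \<circ> \<pi>) = 0 \<and> restrict id {1..n} \<circ> \<pi> \<in> multi_idx n n"
      using \<pi>
    proof (induction rule: permutes_rev_induct[OF finite_atLeastAtMost, consumes 1, case_names id swap])
      case (swap a b p)
      then have f: "f (restrict id {1..n} \<circ> p) = 0" and p: "restrict id {1..n} \<circ> p \<in> multi_idx n n"
        by blast+
      have "alternating n n a b f" by (rule all) (fact swap)+
      from alternatingD[OF this p] multi_idx_transpose[OF p swap(1,2)] show ?case
        unfolding f by (simp only: comp_assoc minus_zero simp_thms)
    qed (simp only: comp_id id multi_idx_self simp_thms)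
    moreover have "restrict id {1..n} \<circ> \<pi> = q"
    proof
      fix x
      show "(restrict id {1..n} \<circ> \<pi>) x = q x"
        using q multi_idx_apply[OF q, of x] PiE_arb[of q "{1..n}" "\<lambda>_. {1..n}" x]
        by (cases "x \<in> {1..n}") (auto simp: \<pi>_def multi_idx_def)
    qed
    ultimately show ?thesis by simp
  qed
qed

section \<open>Rows of the antisymmetrizer\<close>

text \<open>Composing the summation variable with the transposition permutes the terms and flips
  every sign.\<close>

lemma antisymmetrizer_alternating:
  assumes "i \<in> {1..n}" "j \<in> {1..n}" "i \<noteq> j"
  shows "alternating n k i j (antisymmetrizer n p :: _ \<Rightarrow> 'r::ring_1)"
  unfolding alternating_def
proof
  fix q
  let ?t = "Transposition.transpose i j"
  have t: "?t permutes {1..n}" using assms by (intro permutes_swap_id) auto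
  have eq: "p = q \<circ> ?t \<circ> \<sigma> \<longleftrightarrow> p = q \<circ> (?t \<circ> \<sigma>)" for \<sigma>
    by (simp add: comp_assoc)
  have sgn: "sign (?t \<circ> \<sigma>) = - sign \<sigma>" if "\<sigma> permutes {1..n}" for \<sigma>
    using that assms by (simp add: sign_compose permutation_swap_id permutes_imp_permutation[OF finite_atLeastAtMost] sign_swap_id)
  have "(antisymmetrizer n p q :: 'r) = (\<Sum>\<sigma> | \<sigma> permutes {1..n}. of_int (sign (?t \<circ> \<sigma>)) * (if p = q \<circ> (?t \<circ> \<sigma>) then 1 else 0))"
    unfolding antisymmetrizer_def
    by (rule sum.reindex_bij_witness[of _ "(\<circ>) ?t" "(\<circ>) ?t"])
       (auto simp: comp_assoc[symmetric] intro: permutes_compose[OF _ t])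
  also have "\<dots> = - (antisymmetrizer n p (q \<circ> ?t) :: 'r)"
    unfolding antisymmetrizer_def sum_negf[symmetric] eq
    by (intro sum.cong) (auto simp: sgn)
  finally show "antisymmetrizer n p (q \<circ> ?t) = - (antisymmetrizer n p q :: 'r)"
    by (simp only: minus_minus)
qed

lemma restrict_id_comp_permutes:
  assumes "\<sigma> permutes {1..n}"
  shows "restrict id {1..n::nat} \<circ> \<sigma> = restrict \<sigma> {1..n}"
proof
  fix x
  show "(restrict id {1..n} \<circ> \<sigma>) x = restrict \<sigma> {1..n} x"
    using permutes_in_image[OF assms, of x] by simp
qed

lemma restrict_permutes_inj:
  assumes "\<sigma> permutes S" "\<tau> permutes S" "restrict \<sigma> S = restrict \<tau> S"
  shows "\<sigma> = \<tau>"
proof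
  fix x
  show "\<sigma> x = \<tau> x"
    using assms(3)[THEN fun_cong, of x] assms(1,2) by (cases "x \<in> S") (auto simp: permutes_not_in)
qed

text \<open>Only the inverse of \<open>\<sigma>\<close> contributes to the defining sum, and it has
  the same sign as \<open>\<sigma>\<close>.\<close>

lemma antisymmetrizer_id:
  assumes \<sigma>: "\<sigma> permutes {1..n}"
  shows "antisymmetrizer n (restrict id {1..n}) (restrict \<sigma> {1..n}) = of_int (sign \<sigma>)"
proof -
  have "restrict id {1..n} = restrict \<sigma> {1..n} \<circ> \<tau> \<longleftrightarrow> \<tau> = inv \<sigma>" if \<tau>: "\<tau> permutes {1..n}" for \<tau>
  proof -
    have "restrict \<sigma> {1..n} \<circ> \<tau> = restrict id {1..n} \<circ> (\<sigma> \<circ> \<tau>)"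
      by (simp only: restrict_id_comp_permutes[OF \<sigma>, symmetric] comp_assoc)
    also have "\<dots> = restrict (\<sigma> \<circ> \<tau>) {1..n}"
      by (intro restrict_id_comp_permutes permutes_compose \<sigma> \<tau>)
    finally have "restrict id {1..n} = restrict \<sigma> {1..n} \<circ> \<tau> \<longleftrightarrow> \<sigma> \<circ> \<tau> = id"
      using restrict_permutes_inj[OF permutes_compose[OF \<tau> \<sigma>] permutes_id] by auto
    also have "\<dots> \<longleftrightarrow> \<tau> = inv \<sigma>"
    proof
      assume "\<sigma> \<circ> \<tau> = id"
      then have "inv \<sigma> \<circ> (\<sigma> \<circ> \<tau>) = inv \<sigma>" by simp
      then show "\<tau> = inv \<sigma>" by (simp only: comp_assoc[symmetric] permutes_inv_o(2)[OF \<sigma>] id_comp)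
    qed (simp add: permutes_inv_o(1)[OF \<sigma>])
    finally show ?thesis .
  qed
  then have "antisymmetrizer n (restrict id {1..n}) (restrict \<sigma> {1..n}) =
      (\<Sum>\<tau> | \<tau> permutes {1..n}. if \<tau> = inv \<sigma> then of_int (sign (inv \<sigma>)) else 0)"
    unfolding antisymmetrizer_def by (intro sum.cong) auto
  also have "\<dots> = of_int (sign \<sigma>)"
    using permutes_inv[OF \<sigma>] \<sigma>
    by (simp add: finite_permutations sign_inverse permutes_imp_permutation[OF finite_atLeastAtMost])
  finally show ?thesis .
qed

text \<open>The row at the identity is supported on permutations. This is how the signed sum over
  \<open>\<sigma>\<close> in the final formula arises.\<close>

lemma antisymmetrizer_sum:
  fixes T :: "_ \<Rightarrow> 'r::ring_1"
  shows "(\<Sum>p\<in>multi_idx n n. antisymmetrizer n (restrict id {1..n}) p * T p) =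
    (\<Sum>\<sigma> | \<sigma> permutes {1..n}. of_int (sign \<sigma>) * T (restrict \<sigma> {1..n}))"
proof -
  let ?A = "antisymmetrizer n (restrict id {1..n}) :: _ \<Rightarrow> 'r"
  let ?P = "{\<sigma>. \<sigma> permutes {1..n}}"
  have sub: "(\<lambda>\<sigma>. restrict \<sigma> {1..n}) ` ?P \<subseteq> multi_idx n n"
  proof (intro image_subsetI)
    fix \<sigma> assume "\<sigma> \<in> ?P"
    then have "\<sigma> ` {1..n} = {1..n}" by (auto dest: permutes_image)
    then show "restrict \<sigma> {1..n} \<in> multi_idx n n"
      unfolding multi_idx_def by (intro restrict_PiE_iff[THEN iffD2] ballI) (metis imageI)
  qed
  have zero: "?A p = 0" if "p \<notin> (\<lambda>\<sigma>. restrict \<sigma> {1..n}) ` ?P" for p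
    unfolding antisymmetrizer_def
  proof (intro sum.neutral ballI)
    fix \<sigma> assume "\<sigma> \<in> ?P"
    then have \<sigma>: "\<sigma> permutes {1..n}" by simp
    have "p = restrict (inv \<sigma>) {1..n}" if "restrict id {1..n} = p \<circ> \<sigma>"
    proof -
      have "restrict id {1..n} \<circ> inv \<sigma> = p"
        using \<sigma> unfolding that by (simp add: comp_assoc permutes_inv_o)
      then show ?thesis
        using restrict_id_comp_permutes[OF permutes_inv[OF \<sigma>]] by simp
    qed
    then have "restrict id {1..n} \<noteq> p \<circ> \<sigma>"
      using that permutes_inv[OF \<sigma>] by blast
    then show "of_int (sign \<sigma>) * (if restrict id {1..n} = p \<circ> \<sigma> then 1 else 0) = 0"
      by simp
  qed
  have "(\<Sum>p\<in>multi_idx n n. ?A p * T p) = (\<Sum>p\<in>(\<lambda>\<sigma>. restrict \<sigma> {1..n}) ` ?P. ?A p * T p)"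
    by (intro sum.mono_neutral_right finite_multi_idx sub ballI) (simp only: zero Diff_iff not_False_eq_True mult_zero_left)
  also have "\<dots> = (\<Sum>\<sigma>\<in>?P. ?A (restrict \<sigma> {1..n}) * T (restrict \<sigma> {1..n}))"
  proof (subst sum.reindex)
    show "inj_on (\<lambda>\<sigma>. restrict \<sigma> {1..n}) ?P"
      by (intro inj_onI) (drule CollectD, drule CollectD, rule restrict_permutes_inj[of _ "{1..n}"], assumption+)
  qed simp
  also have "\<dots> = (\<Sum>\<sigma>\<in>?P. of_int (sign \<sigma>) * T (restrict \<sigma> {1..n}))"
    by (intro sum.cong refl) (simp add: antisymmetrizer_id)
  finally show ?thesis .
qed

section \<open>Evaluation of power series in two central variables\<close>

text \<open>Substitution of \<open>x\<close> for the outer and \<open>y\<close> for the inner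
  variable. When both have zero constant term, monomials of total degree above \<open>k\<close> do
  not reach coefficient \<open>k\<close>, so the finite sums give the full substitution. It serves
  to specialise the reflection equation, an identity in two variables, to two shifts of
  \<open>u\<close>.\<close>

definition fps_eval2 :: "'a::ring_1 fps \<Rightarrow> 'a fps \<Rightarrow> 'a fps fps \<Rightarrow> 'a fps" where
  "fps_eval2 x y F = Abs_fps (\<lambda>k. (\<Sum>r\<le>k. \<Sum>s\<le>k. fps_const (F $ r $ s) * x ^ r * y ^ s) $ k)"

lemma sum_triangle_reindex:
  fixes g :: "nat \<Rightarrow> nat \<Rightarrow> 'a::comm_monoid_add"
  assumes "\<And>i j. K < i + j \<Longrightarrow> g i j = 0"
  shows "(\<Sum>i\<le>K. \<Sum>j\<le>K. g i j) = (\<Sum>a\<le>K. \<Sum>i\<le>a. g i (a - i))"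
proof -
  have "(\<Sum>i\<le>K. \<Sum>j\<le>K. g i j) = (\<Sum>(i, j)\<in>{..K} \<times> {..K}. g i j)"
    by (simp add: sum.cartesian_product)
  also have "\<dots> = (\<Sum>(i, j)\<in>{(i, j). i + j \<le> K}. g i j)"
    using assms by (intro sum.mono_neutral_right) (auto simp: not_le[symmetric])
  also have "\<dots> = (\<Sum>a\<le>K. \<Sum>i\<le>a. g i (a - i))"
    by (rule sum.triangle_reindex_eq)
  finally show ?thesis .
qed

lemma fps_const_sum: "fps_const (\<Sum>i\<in>I. f i) = (\<Sum>i\<in>I. fps_const (f i :: 'a::ring_1))"
  by (induction I rule: infinite_finite_induct) (simp_all flip: fps_const_add)

lemma fps_mult_nth_eq_0:
  fixes f g :: "'a::ring_1 fps"
  assumes "\<And>k. k < a \<Longrightarrow> f $ k = 0" "\<And>k. k < b \<Longrightarrow> g $ k = 0" "k < a + b"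
  shows "(f * g) $ k = 0"
  unfolding fps_mult_nth
proof (intro sum.neutral ballI)
  fix i assume "i \<in> {0..k}"
  then have "i < a \<or> k - i < b" using assms(3) by auto
  then show "f $ i * g $ (k - i) = 0" using assms(1,2) by auto
qed

context
  fixes x y :: "'a::ring_1 fps"
  assumes x0: "x $ 0 = 0" and y0: "y $ 0 = 0"
    and xc: "\<And>f. x * f = f * x" and yc: "\<And>f. y * f = f * y"
begin

lemma fps_eval2_monomial_nth_eq_0:
  assumes "k < r + s"
  shows "(c * x ^ r * y ^ s) $ k = 0"
  unfolding mult.assoc
  using startsby_zero_power_prefix[OF x0, of r] startsby_zero_power_prefix[OF y0, of s] assms
    fps_mult_nth_eq_0[of r "x ^ r" s "y ^ s"] 
  by (intro fps_mult_nth_eq_0[of 0 c "r + s"]) auto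

text \<open>The truncation bound may be enlarged, so the coefficients of all factors of a product
  can be read off with one common bound.\<close>

lemma fps_eval2_nth:
  assumes "k \<le> K"
  shows "fps_eval2 x y F $ k = (\<Sum>r\<le>K. \<Sum>s\<le>K. fps_const (F $ r $ s) * x ^ r * y ^ s) $ k"
proof -
  let ?h = "\<lambda>(r, s). (fps_const (F $ r $ s) * x ^ r * y ^ s) $ k"
  have "fps_eval2 x y F $ k = sum ?h ({..k} \<times> {..k})"
    by (simp add: fps_eval2_def fps_sum_nth flip: sum.cartesian_product)
  also have "\<dots> = sum ?h ({..K} \<times> {..K})"
    using assms by (intro sum.mono_neutral_left) (auto intro: fps_eval2_monomial_nth_eq_0)
  finally show ?thesis
    by (simp add: fps_sum_nth flip: sum.cartesian_product)
qed

lemma central_power: "(\<And>f. z * f = f * z) \<Longrightarrow> z ^ r * f = f * (z :: 'a fps) ^ r"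
  by (induction r) (simp_all add: mult.assoc, metis mult.assoc)

lemma fps_eval2_monomial_mult:
  "(fps_const c * x ^ r * y ^ s) * (fps_const d * x ^ r' * y ^ s') =
    fps_const (c * d) * x ^ (r + r') * y ^ (s + s')"
proof -
  have "(fps_const c * x ^ r * y ^ s) * (fps_const d * x ^ r' * y ^ s') =
      fps_const c * (x ^ r * ((y ^ s * (fps_const d * x ^ r')) * y ^ s'))"
    by (simp add: mult.assoc)
  also have "\<dots> = fps_const c * ((x ^ r * fps_const d) * (x ^ r' * (y ^ s * y ^ s')))"
    unfolding central_power[OF yc, of s] by (simp add: mult.assoc flip: power_add) (simp add: add.commute)
  finally show ?thesis
    unfolding central_power[OF xc, of r "fps_const d"]
    by (simp add: mult.assoc power_add flip: fps_const_mult)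
qed

text \<open>For multiplicativity, centrality of \<open>x\<close> and \<open>y\<close> lets monomials
  multiply exponent by exponent. The sums over pairs of exponents are then regrouped by their totals
  into the Cauchy products of the outer and the inner variable.\<close>

lemma is_ring_hom_fps_eval2: "is_ring_hom (fps_eval2 x y)"
  unfolding is_ring_hom_def
proof (intro conjI allI)
  show "fps_eval2 x y 1 = 1"
  proof (rule fps_ext)
    fix k
    have "(\<Sum>r\<le>k. \<Sum>s\<le>k. fps_const ((1 :: 'a fps fps) $ r $ s) * x ^ r * y ^ s) =
        (\<Sum>r\<le>k. \<Sum>s\<le>k. if r = 0 then if s = 0 then 1 else 0 else 0)"
      by (intro sum.cong) auto
    also have "\<dots> = (\<Sum>r\<le>k. if r = 0 then 1 else 0)"
      by (intro sum.cong) auto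
    also have "\<dots> = 1" by simp
    finally show "fps_eval2 x y 1 $ k = 1 $ k" by (simp add: fps_eval2_def)
  qed
  show "fps_eval2 x y (F + G) = fps_eval2 x y F + fps_eval2 x y G" for F G
    by (rule fps_ext)
       (simp add: fps_eval2_def sum.distrib distrib_right flip: fps_const_add)
  show "fps_eval2 x y (F * G) = fps_eval2 x y F * fps_eval2 x y G" for F G
  proof (rule fps_ext)
    fix k
    define T where "T F = (\<Sum>r\<le>k. \<Sum>s\<le>k. fps_const (F $ r $ s) * x ^ r * y ^ s)" for F
    define h where "h r r' s s' = (fps_const (F $ r $ s * G $ r' $ s') * x ^ (r + r') * y ^ (s + s')) $ k"
      for r r' s s'
    \<comment> \<open>Exponents whose sum exceeds \<open>k\<close> do not affect coefficient
      \<open>k\<close>, which lets each square of exponents be replaced by a triangle.\<close>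
    have h0: "h r r' s s' = 0" if "k < r + r' \<or> k < s + s'" for r r' s s'
      unfolding h_def by (rule fps_eval2_monomial_nth_eq_0) (use that in auto)
    have "(fps_eval2 x y F * fps_eval2 x y G) $ k = (T F * T G) $ k"
      unfolding fps_mult_nth T_def by (intro sum.cong) (auto simp: fps_eval2_nth[of _ k])
    also have "T F * T G = (\<Sum>r\<le>k. \<Sum>s\<le>k. \<Sum>r'\<le>k. \<Sum>s'\<le>k.
        fps_const (F $ r $ s * G $ r' $ s') * x ^ (r + r') * y ^ (s + s'))"
      unfolding T_def sum_distrib_right unfolding sum_distrib_left fps_eval2_monomial_mult ..
    also have "\<dots> $ k = (\<Sum>r\<le>k. \<Sum>s\<le>k. \<Sum>r'\<le>k. \<Sum>s'\<le>k. h r r' s s')"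
      by (simp add: fps_sum_nth h_def)
    also have "\<dots> = (\<Sum>r\<le>k. \<Sum>r'\<le>k. \<Sum>s\<le>k. \<Sum>s'\<le>k. h r r' s s')"
      by (intro sum.cong refl sum.swap)
    also have "\<dots> = (\<Sum>a\<le>k. \<Sum>r\<le>a. \<Sum>s\<le>k. \<Sum>s'\<le>k. h r (a - r) s s')"
      by (rule sum_triangle_reindex) (simp add: h0)
    also have "\<dots> = (\<Sum>a\<le>k. \<Sum>r\<le>a. \<Sum>b\<le>k. \<Sum>s\<le>b. h r (a - r) s (b - s))"
      by (intro sum.cong refl sum_triangle_reindex) (simp add: h0)
    also have "\<dots> = (\<Sum>a\<le>k. \<Sum>b\<le>k. \<Sum>r\<le>a. \<Sum>s\<le>b. h r (a - r) s (b - s))"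
      by (intro sum.cong refl sum.swap)
    also have "\<dots> = (\<Sum>a\<le>k. \<Sum>b\<le>k. \<Sum>r\<le>a. \<Sum>s\<le>b.
        fps_const (F $ r $ s * G $ (a - r) $ (b - s)) * x ^ a * y ^ b) $ k"
      unfolding fps_sum_nth by (intro sum.cong refl) (simp add: h_def)
    also have "\<dots> = T (F * G) $ k"
      by (simp only: T_def fps_mult_nth fps_sum_nth atLeast0AtMost sum_distrib_right fps_const_sum)
    finally show "fps_eval2 x y (F * G) $ k = (fps_eval2 x y F * fps_eval2 x y G) $ k"
      by (simp add: T_def fps_eval2_def)
  qed
qed

text \<open>On series in the inner variable alone, evaluation is the composition \<open>oo\<close>
  used in \<open>b_shift\<close>; the next lemma is the counterpart for the outer variable.\<close>

lemma fps_eval2_const: "fps_eval2 x y (fps_const f) = f oo y"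
proof (rule fps_ext)
  fix k
  have "(\<Sum>r\<le>k. \<Sum>s\<le>k. fps_const (fps_const f $ r $ s) * x ^ r * y ^ s) =
      (\<Sum>r\<le>k. if r = 0 then \<Sum>s\<le>k. fps_const (f $ s) * y ^ s else 0)"
    by (intro sum.cong) auto
  also have "\<dots> = (\<Sum>s\<le>k. fps_const (f $ s) * y ^ s)"
    by simp
  finally show "fps_eval2 x y (fps_const f) $ k = (f oo y) $ k"
    unfolding fps_eval2_def fps_nth_Abs_fps by (simp add: fps_compose_nth fps_sum_nth atLeast0AtMost)
qed

lemma fps_eval2_outer: "fps_eval2 x y (Abs_fps (\<lambda>r. fps_const (f $ r))) = f oo x"
proof (rule fps_ext)
  fix k
  have "(\<Sum>r\<le>k. \<Sum>s\<le>k. fps_const (Abs_fps (\<lambda>r. fps_const (f $ r)) $ r $ s) * x ^ r * y ^ s) =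
      (\<Sum>r\<le>k. \<Sum>s\<le>k. if s = 0 then fps_const (f $ r) * x ^ r else 0)"
    by (intro sum.cong) auto
  also have "\<dots> = (\<Sum>r\<le>k. fps_const (f $ r) * x ^ r)"
    by simp
  finally show "fps_eval2 x y (Abs_fps (\<lambda>r. fps_const (f $ r))) $ k = (f oo x) $ k"
    unfolding fps_eval2_def fps_nth_Abs_fps[of "\<lambda>k. _ k $ k"]
    by (simp add: fps_compose_nth fps_sum_nth atLeast0AtMost)
qed

lemma fps_X_compose_startby0: "z $ 0 = 0 \<Longrightarrow> fps_X oo z = (z :: 'a fps)"
  by (simp add: fps_eq_iff fps_compose_def mult_delta_left not_le fps_X_def if_distrib[of "\<lambda>c. c * _"] cong: if_cong)

lemma fps_eval2_X: "fps_eval2 x y fps_X = x" "fps_eval2 x y (fps_const fps_X) = y"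
proof -
  have "(fps_X :: 'a fps fps) = Abs_fps (\<lambda>r. fps_const (fps_X $ r))"
    by (auto simp: fps_eq_iff fps_X_def)
  then show "fps_eval2 x y fps_X = x"
    using fps_eval2_outer[of fps_X] fps_X_compose_startby0[OF x0] by simp
  show "fps_eval2 x y (fps_const fps_X) = y"
    using fps_eval2_const fps_X_compose_startby0[OF y0] by simp
qed

end

section \<open>Products of matrices acting at prescribed positions\<close>

text \<open>
  A factor is \<open>fresh\<close> if it is the first in its fibre; otherwise \<open>s k\<close> is the summation index shared
  by the \<open>k\<close>-th factor and its predecessor in the fibre. With this indexing only the upper index of
  the predecessor changes when a factor is appended on the right.
\<close>

lemma row_at_path:
  fixes X :: "nat \<Rightarrow> nat \<Rightarrow> nat \<Rightarrow> 'r::ring_1"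
  assumes \<eta>: "\<And>k. k \<in> {1..n} \<Longrightarrow> \<eta> k \<in> {1..n}"
    and p: "p \<in> multi_idx n n" and "m \<le> n" and "q \<in> multi_idx n n"
  defines "fresh \<equiv> \<lambda>k. \<forall>k'\<in>{1..<k}. \<eta> k' \<noteq> \<eta> k"
  defines "lo \<equiv> \<lambda>s k. if fresh k then p (\<eta> k) else s k"
  defines "up \<equiv> \<lambda>m q s k. if \<exists>k'. k < k' \<and> k' \<le> m \<and> \<eta> k' = \<eta> k
      then s (LEAST k'. k < k' \<and> \<eta> k' = \<eta> k) else q (\<eta> k)"
  shows "fold (\<lambda>k. row_at n (\<eta> k) (X k)) [1..<m + 1] (tens_one p) q =
    (if \<forall>N\<in>{1..n} - \<eta> ` {1..m}. p N = q N
     then \<Sum>s\<in>{k\<in>{1..m}. \<not> fresh k} \<rightarrow>\<^sub>E {1..n}. \<Prod>k\<leftarrow>[1..<m + 1]. X k (lo s k) (up m q s k)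
     else 0)"
  using assms(3,4)
proof (induction m arbitrary: q)
  case 0
  then have "(\<forall>N\<in>{1..n}. p N = q N) \<longleftrightarrow> p = q"
    using p by (auto simp: multi_idx_def intro: PiE_ext)
  then show ?case by (simp add: tens_one_def)
next
  case (Suc m)
  let ?M = "Suc m"
  let ?S = "\<lambda>m. {k\<in>{1..m}. \<not> fresh k}"
  have upt: "[1..<?M + 1] = [1..<m + 1] @ [?M]"
    by simp
  have path_eq: "(\<Prod>k\<leftarrow>[1..<m + 1]. X k (a k) (b k)) = (\<Prod>k\<leftarrow>[1..<m + 1]. X k (a' k) (b' k))"
    if "\<And>k. k \<in> {1..m} \<Longrightarrow> a k = a' k" "\<And>k. k \<in> {1..m} \<Longrightarrow> b k = b' k" for a b a' b'
    using that by (intro arg_cong[where f = prod_list] map_cong refl) auto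
  have \<eta>M: "\<eta> ?M \<in> {1..n}" using \<eta> Suc.prems by simp
  define G where "G q' = (\<Sum>s\<in>?S m \<rightarrow>\<^sub>E {1..n}. \<Prod>k\<leftarrow>[1..<m + 1]. X k (lo s k) (up m q' s k))" for q'
  have "fold (\<lambda>k. row_at n (\<eta> k) (X k)) [1..<?M + 1] (tens_one p) q =
      (\<Sum>t\<in>{1..n}. fold (\<lambda>k. row_at n (\<eta> k) (X k)) [1..<m + 1] (tens_one p) (q(\<eta> ?M := t)) * X ?M t (q (\<eta> ?M)))"
    unfolding upt by (simp add: row_at_def)
  also have "\<dots> = (\<Sum>t\<in>{1..n}. (if \<forall>N\<in>{1..n} - \<eta> ` {1..m}. p N = (q(\<eta> ?M := t)) N then G (q(\<eta> ?M := t)) else 0) * X ?M t (q (\<eta> ?M)))"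
    unfolding G_def using Suc.prems \<eta>M
    by (intro sum.cong refl arg_cong2[where f = times] Suc.IH multi_idx_upd) auto
  finally have step: "fold (\<lambda>k. row_at n (\<eta> k) (X k)) [1..<?M + 1] (tens_one p) q = \<dots>" .
  have im: "\<eta> ` {1..?M} = insert (\<eta> ?M) (\<eta> ` {1..m})"
    by (simp add: atLeastAtMostSuc_conv)
  have up_M: "up ?M q s ?M = q (\<eta> ?M)" for s
    unfolding up_def by auto
  show ?case
  proof (cases "fresh ?M")
    case True
    then have new: "\<eta> ?M \<notin> \<eta> ` {1..m}"
      unfolding fresh_def by (fastforce simp: less_Suc_eq_le)
    have S: "?S ?M = ?S m"
      using True by (auto simp: le_Suc_eq)
    \<comment> \<open>No earlier factor acts at position \<open>\<eta> ?M\<close>, so the identity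
      matrix \<open>tens_one\<close> still forces equality there and collapses the sum over
      \<open>t\<close> to one term.\<close>
    have cond: "(\<forall>N\<in>{1..n} - \<eta> ` {1..m}. p N = (q(\<eta> ?M := t)) N) \<longleftrightarrow>
        t = p (\<eta> ?M) \<and> (\<forall>N\<in>{1..n} - \<eta> ` {1..?M}. p N = q N)" for t
      unfolding im using new \<eta>M by auto
    have up: "up m (q(\<eta> ?M := t)) s k = up ?M q s k" if "k \<in> {1..m}" for t s k
    proof -
      have "\<eta> ?M \<noteq> \<eta> k" using new that by (metis imageI)
      then show ?thesis unfolding up_def by (auto simp: le_Suc_eq)
    qed
    have path_up: "(\<Prod>k\<leftarrow>[1..<m + 1]. X k (lo s k) (up m (q(\<eta> ?M := t)) s k)) =
        (\<Prod>k\<leftarrow>[1..<m + 1]. X k (lo s k) (up ?M q s k))" for t s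
      by (intro path_eq refl up)
    have "G (q(\<eta> ?M := t)) * X ?M t (q (\<eta> ?M)) =
        (\<Sum>s\<in>?S ?M \<rightarrow>\<^sub>E {1..n}. \<Prod>k\<leftarrow>[1..<?M + 1]. X k (lo s k) (up ?M q s k))" if "t = p (\<eta> ?M)" for t
    proof -
      have "lo s ?M = t" for s using True that by (simp add: lo_def)
      then show ?thesis
        unfolding G_def S sum_distrib_right
        unfolding upt by (intro sum.cong refl) (simp add: up_M path_up)
    qed
    then have "(\<Sum>t\<in>{1..n}. (if t = p (\<eta> ?M) \<and> C then G (q(\<eta> ?M := t)) else 0) * X ?M t (q (\<eta> ?M))) =
       (if C then \<Sum>s\<in>?S ?M \<rightarrow>\<^sub>E {1..n}. \<Prod>k\<leftarrow>[1..<?M + 1]. X k (lo s k) (up ?M q s k) else 0)" for C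
      using multi_idx_apply[OF p \<eta>M] by (simp add: if_distrib[of "\<lambda>x. x * _"] cong: if_cong)
    then show ?thesis
      unfolding step cond .
  next
    case False
    then obtain k' where "k' \<in> {1..<?M}" "\<eta> k' = \<eta> ?M"
      unfolding fresh_def by blast
    then have old: "\<eta> ?M \<in> \<eta> ` {1..m}"
      by (intro image_eqI[of _ _ k']) auto
    have S: "?S ?M = insert ?M (?S m)" "?M \<notin> ?S m"
      using False by (auto simp: le_Suc_eq)
    \<comment> \<open>An earlier factor has already acted at this position, so \<open>t\<close>
      remains free and becomes the new summation index \<open>s ?M\<close>.\<close>
    have cond: "(\<forall>N\<in>{1..n} - \<eta> ` {1..m}. p N = (q(\<eta> ?M := t)) N) \<longleftrightarrow>
        (\<forall>N\<in>{1..n} - \<eta> ` {1..?M}. p N = q N)" for t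
      unfolding im using old by auto
    have lo_upd: "lo (s(?M := t)) k = lo s k" if "k \<in> {1..m}" for s t k
      using that unfolding lo_def by auto
    \<comment> \<open>The factor that was last in the fibre acquires \<open>?M\<close> as its
      successor: its upper index, formerly the entry \<open>t\<close> of the modified
      \<open>q\<close>, is now read from \<open>s ?M\<close>. All other upper indices are
      unchanged.\<close>
    have up_upd: "up ?M q (s(?M := t)) k = up m (q(\<eta> ?M := t)) s k" if "k \<in> {1..m}" for s t k
    proof (cases "\<exists>k'. k < k' \<and> k' \<le> m \<and> \<eta> k' = \<eta> k")
      case True
      then obtain k' where k': "k < k' \<and> \<eta> k' = \<eta> k" "k' \<le> m" by auto
      have "(LEAST k'. k < k' \<and> \<eta> k' = \<eta> k) \<le> k'"
        by (rule Least_le[of "\<lambda>k'. k < k' \<and> \<eta> k' = \<eta> k", OF k'(1)])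
      moreover have "\<exists>k'. k < k' \<and> k' \<le> ?M \<and> \<eta> k' = \<eta> k"
        using k' by auto
      ultimately show ?thesis
        using True k'(2) unfolding up_def by auto
    next
      case False
      show ?thesis
      proof (cases "\<eta> ?M = \<eta> k")
        case True
        have "(LEAST k'. k < k' \<and> \<eta> k' = \<eta> k) = ?M"
          using True that False by (intro Least_equality) (auto simp: not_less_eq_eq[symmetric])
        moreover have "\<exists>k'. k < k' \<and> k' \<le> ?M \<and> \<eta> k' = \<eta> k"
          using True that by (intro exI[of _ ?M]) auto
        ultimately show ?thesis
          using False True unfolding up_def by auto
      next
        case neq: False
        then show ?thesis
          using False neq[symmetric] unfolding up_def by (auto simp: le_Suc_eq)
      qed
    qed
    have path_upd: "(\<Prod>k\<leftarrow>[1..<m + 1]. X k (lo (s(?M := t)) k) (up ?M q (s(?M := t)) k)) =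
        (\<Prod>k\<leftarrow>[1..<m + 1]. X k (lo s k) (up m (q(\<eta> ?M := t)) s k))" for t s
      by (intro path_eq lo_upd up_upd)
    have "(\<Sum>s\<in>?S ?M \<rightarrow>\<^sub>E {1..n}. \<Prod>k\<leftarrow>[1..<?M + 1]. X k (lo s k) (up ?M q s k)) =
        (\<Sum>(t, s)\<in>{1..n} \<times> (?S m \<rightarrow>\<^sub>E {1..n}). \<Prod>k\<leftarrow>[1..<?M + 1]. X k (lo (s(?M := t)) k) (up ?M q (s(?M := t)) k))"
      unfolding S(1) PiE_insert_eq
      by (subst sum.reindex[OF inj_combinator[OF S(2)]]) (simp add: case_prod_unfold)
    also have "\<dots> = (\<Sum>t\<in>{1..n}. \<Sum>s\<in>?S m \<rightarrow>\<^sub>E {1..n}. \<Prod>k\<leftarrow>[1..<?M + 1]. X k (lo (s(?M := t)) k) (up ?M q (s(?M := t)) k))"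
      by (simp add: sum.cartesian_product)
    also have "\<dots> = (\<Sum>t\<in>{1..n}. G (q(\<eta> ?M := t)) * X ?M t (q (\<eta> ?M)))"
    proof (intro sum.cong refl)
      fix t
      have "lo (s(?M := t)) ?M = t" for s using False by (simp add: lo_def)
      then show "(\<Sum>s\<in>?S m \<rightarrow>\<^sub>E {1..n}. \<Prod>k\<leftarrow>[1..<?M + 1]. X k (lo (s(?M := t)) k) (up ?M q (s(?M := t)) k)) =
          G (q(\<eta> ?M := t)) * X ?M t (q (\<eta> ?M))"
        unfolding G_def sum_distrib_right
        unfolding upt by (intro sum.cong refl) (simp add: up_M path_upd)
    qed
    finally have eq: "(\<Sum>s\<in>?S ?M \<rightarrow>\<^sub>E {1..n}. \<Prod>k\<leftarrow>[1..<?M + 1]. X k (lo s k) (up ?M q s k)) = \<dots>" .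
    have "(\<Sum>t\<in>{1..n}. (if C then a t else 0) * b t) = (if C then \<Sum>t\<in>{1..n}. a t * b t else 0)" for C and a b :: "nat \<Rightarrow> 'r"
      by simp
    then show ?thesis
      unfolding step cond eq .
  qed
qed

section \<open>Blocks of the Sklyanin product\<close>

text \<open>The weight depends on \<open>i + j\<close> only, as does the argument 2u - i - j + 2 of
  R on the legs \<open>i\<close> and \<open>j\<close>.\<close>

definition row_Rs :: "(nat \<Rightarrow> 'r::ring_1) \<Rightarrow> nat \<Rightarrow> nat list \<Rightarrow> ((nat \<Rightarrow> nat) \<Rightarrow> 'r) \<Rightarrow> (nat \<Rightarrow> nat) \<Rightarrow> 'r" where
  "row_Rs w i js = fold (\<lambda>j. row_R (w (i + j)) i j) js"

definition row_block :: "nat \<Rightarrow> (nat \<Rightarrow> nat \<Rightarrow> nat \<Rightarrow> 'r::ring_1) \<Rightarrow> (nat \<Rightarrow> 'r) \<Rightarrow> nat \<Rightarrow>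
    ((nat \<Rightarrow> nat) \<Rightarrow> 'r) \<Rightarrow> (nat \<Rightarrow> nat) \<Rightarrow> 'r" where
  "row_block n X w i f = row_Rs w i [i + 1..<n + 1] (row_at n i (X i) f)"

definition row_Z :: "nat \<Rightarrow> (nat \<Rightarrow> nat \<Rightarrow> nat \<Rightarrow> 'r::ring_1) \<Rightarrow> (nat \<Rightarrow> 'r) \<Rightarrow> nat \<Rightarrow>
    ((nat \<Rightarrow> nat) \<Rightarrow> 'r) \<Rightarrow> (nat \<Rightarrow> nat) \<Rightarrow> 'r" where
  "row_Z n X w i f q = row_at n i (X i) f q + w (i + n) * (\<Sum>k\<in>{i + 1..n}. row_at n k (X i) f q)"

lemma row_Rs_Cons: "row_Rs w i (j # js) f = row_Rs w i js (row_R (w (i + j)) i j f)"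
  by (simp add: row_Rs_def)

lemma row_Rs_append: "row_Rs w i (js @ ks) f = row_Rs w i ks (row_Rs w i js f)"
  by (simp add: row_Rs_def)

lemma row_Rs_Nil: "row_Rs w i [] f = f"
  by (simp add: row_Rs_def)

lemma row_Rs_cong:
  assumes "\<And>q. q \<in> multi_idx n k \<Longrightarrow> f q = g q" "i \<in> {1..k}" "set js \<subseteq> {1..k}" "q \<in> multi_idx n k"
  shows "row_Rs w i js f q = row_Rs w i js g q"
  using assms(1,3,4)
proof (induction js arbitrary: f g q)
  case (Cons j js)
  have "row_R (w (i + j)) i j f q = row_R (w (i + j)) i j g q" if "q \<in> multi_idx n k" for q
    using Cons.prems assms(2) that by (intro row_R_cong[of n k f g]) auto
  moreover have "set js \<subseteq> {1..k}"
    using Cons.prems by simp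
  ultimately show ?case
    unfolding row_Rs_Cons using Cons.prems(3) by (rule Cons.IH)
qed (simp add: row_Rs_Nil)

lemma row_block_cong:
  assumes "\<And>q. q \<in> multi_idx n n \<Longrightarrow> f q = g q" "i \<in> {1..n}" "q \<in> multi_idx n n"
  shows "row_block n X w i f q = row_block n X w i g q"
  unfolding row_block_def using assms
  by (intro row_Rs_cong[of n n] row_at_cong[of n n f g]) auto

lemma alternating_row_Rs:
  assumes "alternating n k i j f" "i \<in> {1..k}" "j \<in> {1..k}" "a \<in> {1..k}" "a \<noteq> i" "a \<noteq> j"
    "set js \<subseteq> {1..k} - {i, j}"
  shows "alternating n k i j (row_Rs w a js f)"
  using assms(1,7)
proof (induction js arbitrary: f)
  case (Cons b js)
  have "alternating n k i j (row_R (w (a + b)) a b f)"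
    using Cons.prems assms(2-6) by (intro alternating_row_R) auto
  then show ?case
    using Cons unfolding row_Rs_Cons by simp
qed (simp add: row_Rs_Nil)

lemma row_at_row_Rs_commute:
  assumes "l \<noteq> i" "l \<notin> set js"
  shows "row_at n l X (row_Rs w i js f) = row_Rs w i js (row_at n l X f)"
  using assms(2)
proof (induction js arbitrary: f)
  case (Cons j js)
  then have "row_at n l X (row_Rs w i (j # js) f) = row_Rs w i js (row_at n l X (row_R (w (i + j)) i j f))"
    unfolding row_Rs_Cons by simp
  also have "row_at n l X (row_R (w (i + j)) i j f) = row_R (w (i + j)) i j (row_at n l X f)"
    using Cons.prems assms(1) by (intro row_at_row_R_commute) auto
  finally show ?case
    unfolding row_Rs_Cons .
qed (simp add: row_Rs_Nil)

text \<open>\<open>w (i + j)\<close> is the scalar \<open>1/(2u + 2 - i - j)\<close>, for which \<open>weight_step\<close> is the Yang--Baxter condition.\<close>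

locale R_weights =
  fixes w :: "nat \<Rightarrow> 'r::ring_1"
  assumes central: "w a * x = x * w a"
    and weight_step: "w a + w (Suc a) * w a = w (Suc a)"
begin

lemma row_R_row_Rs_commute:
  assumes "l \<noteq> i" "j \<noteq> i" "l \<notin> set js" "j \<notin> set js"
  shows "row_R (w b) l j (row_Rs w i js f) = row_Rs w i js (row_R (w b) l j f)"
  using assms(3,4)
proof (induction js arbitrary: f)
  case (Cons a js)
  then have "row_R (w b) l j (row_Rs w i (a # js) f) = row_Rs w i js (row_R (w b) l j (row_R (w (i + a)) i a f))"
    unfolding row_Rs_Cons by simp
  also have "row_R (w b) l j (row_R (w (i + a)) i a f) = row_R (w (i + a)) i a (row_R (w b) l j f)"
    using Cons.prems assms(1,2) by (intro row_R_commute central) auto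
  finally show ?case
    unfolding row_Rs_Cons .
qed (simp add: row_Rs_Nil)

text \<open>R is symmetric in its two legs, so this is the earlier statement for factors sharing the
  leg \<open>l\<close>; the consecutive arguments \<open>i + l\<close> and \<open>Suc i + l\<close>
  fit \<open>weight_step\<close>.\<close>

lemma alternating_row_R_pair:
  assumes f: "alternating n k i (Suc i) f"
    and ij: "i \<in> {1..k}" "Suc i \<in> {1..k}" "l \<in> {1..k}" "l \<noteq> i" "l \<noteq> Suc i"
  shows "alternating n k i (Suc i) (row_R (w (Suc i + l)) (Suc i) l (row_R (w (i + l)) i l f))"
proof -
  have "row_R c a b f = row_R c b a f" for c a b and f :: "_ \<Rightarrow> 'r"
    by (simp add: row_R_def transpose_commute fun_eq_iff)
  then show ?thesis
    using alternating_row_R_row_R[OF f ij(1-3) _ ij(4,5), of "w (i + l)" "w (Suc i + l)"] weight_step[of "i + l"]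
    by simp
qed

text \<open>Factors on disjoint legs commute, so the two strings can be shuffled until each R on the
  legs \<open>i\<close> and \<open>a\<close> is directly followed by the one on \<open>Suc i\<close>
  and \<open>a\<close>. Each such pair preserves alternation.\<close>

lemma alternating_row_Rs_interleaved:
  assumes "alternating n k i (Suc i) f" "i \<in> {1..k}" "Suc i \<in> {1..k}"
    "set js \<subseteq> {1..k} - {i, Suc i}" "distinct js"
  shows "alternating n k i (Suc i) (row_Rs w (Suc i) js (row_Rs w i js f))"
  using assms(1,4,5)
proof (induction js arbitrary: f)
  case (Cons a js)
  have "row_Rs w (Suc i) (a # js) (row_Rs w i (a # js) f) =
      row_Rs w (Suc i) js (row_Rs w i js (row_R (w (Suc i + a)) (Suc i) a (row_R (w (i + a)) i a f)))"
    unfolding row_Rs_Cons using Cons.prems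
    by (subst row_R_row_Rs_commute) auto
  moreover have "alternating n k i (Suc i) (row_R (w (Suc i + a)) (Suc i) a (row_R (w (i + a)) i a f))"
    using Cons.prems assms(2,3) by (intro alternating_row_R_pair) auto
  ultimately show ?case
    using Cons by simp
qed (simp add: row_Rs_Nil)

text \<open>The product telescopes. A new factor adds one swap, and its products with the earlier
  swaps reduce to the earlier swaps with opposite sign; \<open>weight_step\<close> merges their
  coefficients into the new weight.\<close>

lemma row_Rs_alternating:
  assumes f: "\<And>j l. j \<in> {i<..m} \<Longrightarrow> l \<in> {i<..m} \<Longrightarrow> j \<noteq> l \<Longrightarrow> alternating n k j l f"
    and im: "1 \<le> i" "i \<le> m" "m \<le> k" and q: "q \<in> multi_idx n k"
  shows "row_Rs w i [i + 1..<m + 1] f q =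
    f q - w (i + m) * (\<Sum>j\<in>{i + 1..m}. f (q \<circ> Transposition.transpose i j))"
  using im(2,3) f q
proof (induction m arbitrary: q rule: dec_induct)
  case base
  then show ?case by (simp add: row_Rs_Nil)
next
  case (step m)
  let ?c = "w (i + m)" and ?d = "w (i + Suc m)" and ?t = "Transposition.transpose i"
  let ?S = "\<lambda>q. \<Sum>j\<in>{i + 1..m}. f (q \<circ> ?t j)"
  have qt: "q \<circ> ?t (Suc m) \<in> multi_idx n k"
    using step im(1) by (intro multi_idx_transpose) auto
  have IH: "row_Rs w i [i + 1..<m + 1] f q = f q - ?c * ?S q" if "q \<in> multi_idx n k" for q
    by (rule step.IH) (use step.prems that in auto)
  have braid: "f (q \<circ> ?t (Suc m) \<circ> ?t j) = - f (q \<circ> ?t j)" if j: "j \<in> {i + 1..m}" for j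
  proof -
    have "q \<circ> ?t (Suc m) \<circ> ?t j = q \<circ> ?t j \<circ> Transposition.transpose (Suc m) j"
      using j step.hyps by (intro transpose_braid(1)) auto
    moreover have "alternating n k (Suc m) j f"
      using j step.hyps step.prems by auto
    moreover have "q \<circ> ?t j \<in> multi_idx n k"
      using j step im(1) by (intro multi_idx_transpose) auto
    ultimately show ?thesis
      using alternatingD by fastforce
  qed
  have "[i + 1..<Suc m + 1] = [i + 1..<m + 1] @ [Suc m]"
    using step.hyps by simp
  then have "row_Rs w i [i + 1..<Suc m + 1] f q =
      row_Rs w i [i + 1..<m + 1] f q - ?d * row_Rs w i [i + 1..<m + 1] f (q \<circ> ?t (Suc m))"
    by (simp only: row_Rs_append row_Rs_Cons row_Rs_Nil) (simp add: row_R_def)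
  also have "\<dots> = (f q - ?c * ?S q) - ?d * (f (q \<circ> ?t (Suc m)) + ?c * ?S q)"
    unfolding IH[OF step.prems(3)] IH[OF qt] using braid by (simp add: sum_negf)
  also have "\<dots> = f q - ((?c + ?d * ?c) * ?S q + ?d * f (q \<circ> ?t (Suc m)))"
    by (simp add: algebra_simps)
  also have "?c + ?d * ?c = ?d"
    using weight_step[of "i + m"] by simp
  also have "?d * ?S q + ?d * f (q \<circ> ?t (Suc m)) = ?d * (\<Sum>j\<in>{i + 1..Suc m}. f (q \<circ> ?t j))"
    using step.hyps by (simp add: distrib_left)
  finally show ?case .
qed

text \<open>Once the matrix has acted at \<open>i\<close>, swapping \<open>i\<close> with
  \<open>k\<close> gives minus its action at \<open>k\<close>. This sign cancels the minus sign in
  the telescoped product.\<close>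

lemma row_block_eq_row_Z:
  assumes f: "\<And>j l. j \<in> {i..n} \<Longrightarrow> l \<in> {i..n} \<Longrightarrow> j \<noteq> l \<Longrightarrow> alternating n n j l f"
    and i: "i \<in> {1..n}" and q: "q \<in> multi_idx n n"
  shows "row_block n X w i f q = row_Z n X w i f q"
proof -
  have "row_at n i (X i) f (q \<circ> Transposition.transpose i k) = - row_at n k (X i) f q"
    if "k \<in> {i + 1..n}" for k
    using row_at_transpose[OF f[of i k] i _ i q] that i by auto
  moreover have "alternating n n j l (row_at n i (X i) f)" if "j \<in> {i<..n}" "l \<in> {i<..n}" "j \<noteq> l" for j l
    using that i f[of j l] by (intro alternating_row_at) auto
  ultimately show ?thesis
    unfolding row_block_def row_Z_def using i q
    by (subst row_Rs_alternating[of _ _ n n]) (auto simp: sum_negf)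
qed

text \<open>A swap of two positions beyond \<open>i\<close> fixes the first summand's position and
  permutes those of the sum, all of which carry the same weight.\<close>

lemma alternating_row_Z:
  assumes f: "alternating n n j l f" and j: "i < j" "j \<le> n" and l: "i < l" "l \<le> n" and i: "1 \<le> i"
  shows "alternating n n j l (row_Z n X w i f)"
  unfolding alternating_def
proof
  fix q assume q: "q \<in> multi_idx n n"
  let ?t = "Transposition.transpose j l"
  have t: "row_at n k (X i) f (q \<circ> ?t) = - row_at n (?t k) (X i) f q" if "k \<in> {1..n}" for k
    using row_at_transpose[OF f _ _ that q] assms by auto
  have "(\<Sum>k\<in>{i + 1..n}. row_at n k (X i) f (q \<circ> ?t)) = - (\<Sum>k\<in>{i + 1..n}. row_at n (?t k) (X i) f q)"
    unfolding sum_negf[symmetric] using i by (intro sum.cong t) auto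
  also have "(\<Sum>k\<in>{i + 1..n}. row_at n (?t k) (X i) f q) = (\<Sum>k\<in>{i + 1..n}. row_at n k (X i) f q)"
    using permutes_swap_id[of j "{i + 1..n}" l] j l by (intro sum.permute[symmetric, unfolded comp_def]) auto
  finally have sum_t: "(\<Sum>k\<in>{i + 1..n}. row_at n k (X i) f (q \<circ> ?t)) =
      - (\<Sum>k\<in>{i + 1..n}. row_at n k (X i) f q)" .
  have "row_at n i (X i) f (q \<circ> ?t) = - row_at n i (X i) f q"
    using t[of i] i j l by simp
  then show "row_Z n X w i f (q \<circ> ?t) = - row_Z n X w i f q"
    unfolding row_Z_def sum_t by simp
qed

lemma fold_row_block_eq_fold_row_Z:
  assumes f: "\<And>j l. j \<in> {1..n} \<Longrightarrow> l \<in> {1..n} \<Longrightarrow> j \<noteq> l \<Longrightarrow> alternating n n j l f"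
    and "m \<le> n" "q \<in> multi_idx n n"
  shows "fold (row_block n X w) [1..<m + 1] f q = fold (row_Z n X w) [1..<m + 1] f q"
proof -
  \<comment> \<open>The induction also carries alternation in the positions beyond \<open>m\<close>,
    which is what the next block needs in order to telescope.\<close>
  have "(\<forall>q\<in>multi_idx n n. fold (row_block n X w) [1..<m + 1] f q = fold (row_Z n X w) [1..<m + 1] f q) \<and>
    (\<forall>j\<in>{m<..n}. \<forall>l\<in>{m<..n}. j \<noteq> l \<longrightarrow> alternating n n j l (fold (row_Z n X w) [1..<m + 1] f))"
    using assms(2)
  proof (induction m)
    case 0
    show ?case using f by simp
  next
    case (Suc m)
    let ?Z = "fold (row_Z n X w) [1..<m + 1] f"
    have upt: "[1..<Suc m + 1] = [1..<m + 1] @ [Suc m]"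
      by simp
    have Z: "fold (row_Z n X w) [1..<Suc m + 1] f = row_Z n X w (Suc m) ?Z"
      unfolding upt by simp
    have alt: "alternating n n j l ?Z" if "j \<in> {Suc m..n}" "l \<in> {Suc m..n}" "j \<noteq> l" for j l
      using Suc that by (auto simp: Suc_le_eq)
    have "fold (row_block n X w) [1..<Suc m + 1] f q = row_Z n X w (Suc m) ?Z q" if q: "q \<in> multi_idx n n" for q
    proof -
      have "fold (row_block n X w) [1..<Suc m + 1] f q =
          row_block n X w (Suc m) (fold (row_block n X w) [1..<m + 1] f) q"
        unfolding upt by simp
      also have "\<dots> = row_block n X w (Suc m) ?Z q"
        using Suc q by (intro row_block_cong) auto
      also have "\<dots> = row_Z n X w (Suc m) ?Z q"
        using Suc.prems alt q by (intro row_block_eq_row_Z) auto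
      finally show ?thesis .
    qed
    then show ?case
      unfolding Z using alt by (auto intro!: alternating_row_Z)
  qed
  then show ?thesis using assms(3) by blast
qed

lemma row_Z_sum:
  assumes "i \<in> {1..n}"
  shows "row_Z n X w i f q = (\<Sum>j\<in>{i..n}. (if i < j then w (i + n) else 1) * row_at n j (X i) f q)"
proof -
  have "{i..n} = insert i {i + 1..n}" using assms by auto
  then show ?thesis
    by (simp add: row_Z_def sum_distrib_left)
qed

lemma row_at_sum: "row_at n i X (\<lambda>q. \<Sum>s\<in>I. c s * g s q) q = (\<Sum>s\<in>I. c s * row_at n i X (g s) q)"
  unfolding row_at_def sum_distrib_right sum_distrib_left
  by (subst sum.swap) (simp add: mult.assoc)

text \<open>The weights come from a commutative ring only to make the product over \<open>i\<close> meaningful.\<close>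

lemma fold_row_Z:
  fixes W :: "nat \<Rightarrow> 'c::comm_ring_1"
  assumes h: "is_ring_hom h" and w: "\<And>a. w a = h (W a)" and "m \<le> n"
  shows "fold (row_Z n X w) [1..<m + 1] f q =
    (\<Sum>\<eta>\<in>(\<Pi>\<^sub>E i\<in>{1..m}. {i..n}). h (\<Prod>i | i \<in> {1..m} \<and> i < \<eta> i. W (i + n)) *
       fold (\<lambda>k. row_at n (\<eta> k) (X k)) [1..<m + 1] f q)"
  using assms(3)
proof (induction m arbitrary: q)
  case 0
  then show ?case by (simp add: is_ring_hom_simps[OF h])
next
  case (Suc m)
  let ?M = "Suc m"
  let ?E = "\<lambda>m. \<Pi>\<^sub>E i\<in>{1..m}. {i..n}"
  let ?W = "\<lambda>m \<eta>. \<Prod>i | i \<in> {1..m} \<and> i < \<eta> i. W (i + n)"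
  let ?f = "\<lambda>m \<eta>. fold (\<lambda>k. row_at n (\<eta> k) (X k)) [1..<m + 1] f"
  have upt: "[1..<?M + 1] = [1..<m + 1] @ [?M]"
    by simp
  have E: "{1..?M} = insert ?M {1..m}" "?M \<notin> {1..m}" by auto
  have W_upd: "h (?W ?M (\<eta>(?M := j))) = (if ?M < j then w (?M + n) else 1) * h (?W m \<eta>)" for \<eta> j
  proof -
    have "{i. i \<in> {1..?M} \<and> i < (\<eta>(?M := j)) i} =
        (if ?M < j then insert ?M else id) {i. i \<in> {1..m} \<and> i < \<eta> i}"
      by (auto simp: le_Suc_eq)
    then show ?thesis
      by (auto simp: w is_ring_hom_simps[OF h])
  qed
  have f_upd: "?f ?M (\<eta>(?M := j)) = row_at n j (X ?M) (?f m \<eta>)" for \<eta> j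
  proof -
    have "fold (\<lambda>k. row_at n ((\<eta>(?M := j)) k) (X k)) [1..<m + 1] f = ?f m \<eta>"
      by (intro fold_cong) auto
    then show ?thesis unfolding upt by simp
  qed
  have "fold (row_Z n X w) [1..<?M + 1] f q = row_Z n X w ?M (fold (row_Z n X w) [1..<m + 1] f) q"
    unfolding upt by simp
  also have "fold (row_Z n X w) [1..<m + 1] f = (\<lambda>q. \<Sum>\<eta>\<in>?E m. h (?W m \<eta>) * ?f m \<eta> q)"
    using Suc by (intro ext) simp
  also have "row_Z n X w ?M \<dots> q = (\<Sum>j\<in>{?M..n}. \<Sum>\<eta>\<in>?E m.
      h (?W ?M (\<eta>(?M := j))) * ?f ?M (\<eta>(?M := j)) q)"
    unfolding W_upd f_upd using Suc.prems
    by (subst row_Z_sum) (simp_all add: row_at_sum sum_distrib_left mult.assoc)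
  also have "\<dots> = (\<Sum>(j, \<eta>)\<in>{?M..n} \<times> ?E m. h (?W ?M (\<eta>(?M := j))) * ?f ?M (\<eta>(?M := j)) q)"
    by (simp only: sum.cartesian_product)
  \<comment> \<open>A choice function on \<open>{1..?M}\<close> is one on \<open>{1..m}\<close>
    together with the position \<open>j\<close> picked at step \<open>?M\<close>.\<close>
  also have "\<dots> = (\<Sum>\<eta>\<in>?E ?M. h (?W ?M \<eta>) * ?f ?M \<eta> q)"
    unfolding E(1) PiE_insert_eq
    by (subst sum.reindex[OF inj_combinator[OF E(2)]]) (simp add: case_prod_unfold)
  finally show ?case .
qed

end

section \<open>Alternation of the full Sklyanin product\<close>

lemma fold_preserves:
  assumes "P f" "\<And>a f. a \<in> set xs \<Longrightarrow> P f \<Longrightarrow> P (h a f)"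
  shows "P (fold h xs f)"
  using assms by (induction xs arbitrary: f) auto

context R_weights
begin

text \<open>In block \<open>a\<close> the factors joining \<open>a\<close> to \<open>i\<close> and
  to \<open>Suc i\<close> are adjacent and preserve alternation as a pair; all other factors avoid
  both positions.\<close>

lemma alternating_row_block_before:
  assumes f: "alternating n n i (Suc i) f" and a: "1 \<le> a" "a < i" and i: "Suc i \<le> n"
  shows "alternating n n i (Suc i) (row_block n X w a f)"
proof -
  have split: "[a + 1..<n + 1] = [a + 1..<i] @ [i, Suc i] @ [Suc (Suc i)..<n + 1]"
  proof -
    have "[a + 1..<n + 1] = [a + 1..<i] @ [i..<n + 1]"
      using a i upt_add_eq_append[of "a + 1" i "n + 1 - i"] by simp
    also have "[i..<n + 1] = [i, Suc i] @ [Suc (Suc i)..<n + 1]"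
      using i by (simp add: upt_conv_Cons)
    finally show ?thesis .
  qed
  have 1: "alternating n n i (Suc i) (row_Rs w a [a + 1..<i] (row_at n a (X a) f))"
    using f a i by (intro alternating_row_Rs alternating_row_at) auto
  have 2: "alternating n n i (Suc i) (row_Rs w a [i, Suc i] (row_Rs w a [a + 1..<i] (row_at n a (X a) f)))"
    unfolding row_Rs_Cons row_Rs_Nil
    using 1 a i weight_step[of "a + i"] by (intro alternating_row_R_row_R) auto
  show ?thesis
    unfolding row_block_def split row_Rs_append
    by (rule alternating_row_Rs[OF 2]) (use a i in auto)
qed

text \<open>Blocks before \<open>i\<close> and after \<open>Suc i\<close> preserve alternation one
  by one. The two blocks between them do so only jointly, and this is where the reflection equation
  enters.\<close>

lemma alternating_fold_row_block:
  assumes f: "alternating n n i (Suc i) f" and i: "1 \<le> i" "Suc i \<le> n"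
    and two: "\<And>x::'r. 2 * x = 0 \<Longrightarrow> x = 0"
    and refl: "\<And>f q. q \<in> multi_idx n n \<Longrightarrow>
      row_at n (Suc i) (X (Suc i)) (row_R (w (i + Suc i)) i (Suc i) (row_at n i (X i) (row_R 1 i (Suc i) f))) q =
      row_R 1 i (Suc i) (row_at n i (X i) (row_R (w (i + Suc i)) i (Suc i) (row_at n (Suc i) (X (Suc i)) f))) q"
  shows "alternating n n i (Suc i) (fold (row_block n X w) [1..<n + 1] f)"
proof -
  let ?alt = "alternating n n i (Suc i)" and ?J = "[Suc (Suc i)..<n + 1]"
  have split: "[1..<n + 1] = [1..<i] @ [i, Suc i] @ ?J"
  proof -
    have "[1..<n + 1] = [1..<i] @ [i..<n + 1]"
      using i upt_add_eq_append[of 1 i "n + 1 - i"] by simp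
    also have "[i..<n + 1] = [i, Suc i] @ ?J"
      using i by (simp add: upt_conv_Cons)
    finally show ?thesis .
  qed
  have pair: "?alt (row_block n X w (Suc i) (row_block n X w i g))" if g: "?alt g" for g
  proof -
    have "[Suc i..<n + 1] = Suc i # ?J" "[Suc i + 1..<n + 1] = ?J"
      using i by (simp_all add: upt_conv_Cons flip: Suc_eq_plus1)
    then have "row_block n X w (Suc i) (row_block n X w i g) =
        row_Rs w (Suc i) ?J (row_at n (Suc i) (X (Suc i))
          (row_Rs w i ?J (row_R (w (i + Suc i)) i (Suc i) (row_at n i (X i) g))))"
      by (simp add: row_block_def row_Rs_Cons flip: Suc_eq_plus1)
    \<comment> \<open>The matrix at \<open>Suc i\<close> moves past the R factors that avoid this
      leg. The first three operators then form the pattern of \<open>alternating_reflection\<close>,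
      and the two remaining strings are interleaved.\<close>
    also have "\<dots> = row_Rs w (Suc i) ?J (row_Rs w i ?J (row_at n (Suc i) (X (Suc i))
          (row_R (w (i + Suc i)) i (Suc i) (row_at n i (X i) g))))"
      by (subst row_at_row_Rs_commute) auto
    finally show ?thesis
      using i alternating_reflection[OF g _ _ two refl]
      by (auto intro!: alternating_row_Rs_interleaved)
  qed
  have after: "?alt (row_block n X w a g)" if "?alt g" "a \<in> set ?J" for a g
    unfolding row_block_def using that i
    by (intro alternating_row_Rs alternating_row_at) auto
  have "?alt (fold (row_block n X w) [1..<i] f)"
    using f i by (intro fold_preserves[of ?alt] alternating_row_block_before) auto
  from pair[OF this] have "?alt (fold (row_block n X w) [i, Suc i] (fold (row_block n X w) [1..<i] f))"
    by simp
  then show ?thesis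
    unfolding split fold_append comp_apply by (rule fold_preserves[of ?alt]) (rule after)
qed

end

section \<open>Tensors acting on row vectors\<close>

definition row_act :: "nat \<Rightarrow> nat \<Rightarrow> ((nat \<Rightarrow> nat) \<Rightarrow> 'r::ring_1) \<Rightarrow> 'r tens \<Rightarrow> (nat \<Rightarrow> nat) \<Rightarrow> 'r" where
  "row_act n k f X q = (\<Sum>p\<in>multi_idx n k. f p * X p q)"

lemma row_act_cong:
  assumes "\<And>q. q \<in> multi_idx n k \<Longrightarrow> f q = g q"
  shows "row_act n k f X q = row_act n k g X q"
  unfolding row_act_def using assms by (intro sum.cong) auto

lemma row_act_tens_mult: "row_act n k f (tens_mult n k X Y) q = row_act n k (row_act n k f X) Y q"
  unfolding row_act_def tens_mult_def sum_distrib_left sum_distrib_right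
  by (subst sum.swap) (simp add: mult.assoc)

lemma row_act_tens_one:
  "q \<in> multi_idx n k \<Longrightarrow> row_act n k f tens_one q = f q"
  "p \<in> multi_idx n k \<Longrightarrow> row_act n k (tens_one p) X q = X p q"
  by (simp_all add: row_act_def tens_one_def finite_multi_idx if_distrib[of "\<lambda>x. x * _"] if_distrib[of "\<lambda>x. _ * x"] cong: if_cong)

lemma row_act_tens_prod_Nil: "q \<in> multi_idx n k \<Longrightarrow> row_act n k f (tens_prod n k []) q = f q"
  by (simp add: tens_prod_def row_act_tens_one)

lemma row_act_tens_prod_Cons:
  "row_act n k f (tens_prod n k (X # Xs)) q = row_act n k (row_act n k f X) (tens_prod n k Xs) q"
  by (simp add: tens_prod_def row_act_tens_mult)

lemma row_act_tens_prod_append: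
  "q \<in> multi_idx n k \<Longrightarrow> row_act n k f (tens_prod n k (Xs @ Ys)) q =
    row_act n k (row_act n k f (tens_prod n k Xs)) (tens_prod n k Ys) q"
proof (induction Xs arbitrary: f)
  case Nil
  show ?case unfolding append_Nil by (rule row_act_cong) (rule row_act_tens_prod_Nil[symmetric])
next
  case (Cons X Xs)
  show ?case
    unfolding append_Cons row_act_tens_prod_Cons Cons.IH[OF Cons.prems]
    by (rule row_act_cong) (rule refl)
qed

lemma row_act_tens_prod_concat:
  assumes "\<And>x f q. x \<in> set xs \<Longrightarrow> q \<in> multi_idx n k \<Longrightarrow> row_act n k f (tens_prod n k (F x)) q = T x f q"
    and "q \<in> multi_idx n k"
  shows "row_act n k f (tens_prod n k (concat (map F xs))) q = fold T xs f q"
  using assms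
proof (induction xs arbitrary: f)
  case Nil
  then show ?case by (simp add: row_act_tens_prod_Nil)
next
  case (Cons x xs)
  have "row_act n k f (tens_prod n k (concat (map F (x # xs)))) q =
      row_act n k (row_act n k f (tens_prod n k (F x))) (tens_prod n k (concat (map F xs))) q"
    using Cons.prems(2) by (simp add: row_act_tens_prod_append)
  also have "\<dots> = row_act n k (T x f) (tens_prod n k (concat (map F xs))) q"
    by (rule row_act_cong, rule Cons.prems(1)) simp_all
  also have "\<dots> = fold T xs (T x f) q"
    by (intro Cons.IH Cons.prems) simp_all
  finally show ?case by simp
qed

lemma row_act_tens_prod_map:
  assumes "\<And>x f q. x \<in> set xs \<Longrightarrow> q \<in> multi_idx n k \<Longrightarrow> row_act n k f (F x) q = T x f q"
    and "q \<in> multi_idx n k"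
  shows "row_act n k f (tens_prod n k (map F xs)) q = fold T xs f q"
proof -
  have "row_act n k f (tens_prod n k [F x]) q = T x f q" if "x \<in> set xs" "q \<in> multi_idx n k" for x f q
    using assms(1)[OF that] that(2) by (simp add: row_act_tens_prod_Cons row_act_tens_prod_Nil)
  from row_act_tens_prod_concat[of xs n k "\<lambda>x. [F x]" T, OF this assms(2)] show ?thesis by simp
qed

lemma row_act_tens_at:
  assumes i: "i \<in> {1..k}" and q: "q \<in> multi_idx n k"
  shows "row_act n k f (tens_at k i X) q = row_at n i X f q"
proof -
  have sub: "(\<lambda>t. q(i := t)) ` {1..n} \<subseteq> multi_idx n k"
    using multi_idx_upd[OF q i] by blast
  have "p = q(i := p i) \<and> p i \<in> {1..n}" if "p \<in> multi_idx n k" "\<forall>t\<in>{1..k} - {i}. p t = q t" for p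
  proof
    show "p = q(i := p i)"
    proof
      fix x
      \<comment> \<open>Indices in \<open>multi_idx\<close> agree outside \<open>{1..k}\<close> by
        extensionality.\<close>
      have "p x = undefined" "q x = undefined" if "x \<notin> {1..k}"
        using q \<open>p \<in> multi_idx n k\<close> unfolding multi_idx_def by (auto dest: PiE_arb[OF _ that])
      then show "p x = (q(i := p i)) x"
        using that(2) by (cases "x \<in> {1..k}") auto
    qed
  qed (rule multi_idx_apply[OF that(1) i])
  then have "p \<in> (\<lambda>t. q(i := t)) ` {1..n}" if "p \<in> multi_idx n k" "\<forall>t\<in>{1..k} - {i}. p t = q t" for p
    using that by (intro image_eqI[of p _ "p i"]) blast+
  then have "tens_at k i X p q = 0" if "p \<in> multi_idx n k - (\<lambda>t. q(i := t)) ` {1..n}" for p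
    unfolding tens_at_def using that by (intro if_not_P) blast
  moreover have "tens_at k i X p q = X (p i) (q i)" if "p \<in> (\<lambda>t. q(i := t)) ` {1..n}" for p
    unfolding tens_at_def using that by (intro if_P) (auto split: if_splits)
  ultimately have "row_act n k f (tens_at k i X) q = (\<Sum>p\<in>(\<lambda>t. q(i := t)) ` {1..n}. f p * X (p i) (q i))"
    unfolding row_act_def
    by (intro sum.mono_neutral_cong_right finite_multi_idx sub) simp_all
  also have "\<dots> = row_at n i X f q"
  proof (subst sum.reindex)
    show "inj_on (\<lambda>t. q(i := t)) {1..n}"
      by (rule inj_onI) (metis fun_upd_same)
  qed (simp add: row_at_def)
  finally show ?thesis .
qed

text \<open>The coefficient \<open>d\<close> accommodates the R matrices with cleared denominators.
  A row action places coefficients on the right; centrality brings them to the left, as in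
  \<open>row_R\<close>.\<close>

lemma row_act_one_minus_swap:
  assumes "i \<in> {1..k}" "j \<in> {1..k}" and q: "q \<in> multi_idx n k" and "\<And>x. d * x = x * d" "\<And>x. c * x = x * c"
  shows "row_act n k f (\<lambda>p q. d * tens_one p q - c * tens_swap i j p q) q =
    d * f q - c * f (q \<circ> Transposition.transpose i j)"
proof -
  have "row_act n k f (\<lambda>p q. d * tens_one p q - c * tens_swap i j p q) q =
    (\<Sum>p\<in>multi_idx n k. (if p = q then f p * d else 0) -
      (if p = q \<circ> Transposition.transpose i j then f p * c else 0))"
    unfolding row_act_def
    by (intro sum.cong refl) (simp only: tens_one_def tens_swap_def right_diff_distrib if_distrib[of "\<lambda>x. _ * x"] mult_1_right mult_zero_right)
  also have "\<dots> = f q * d - f (q \<circ> Transposition.transpose i j) * c"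
    using q multi_idx_transpose[OF q assms(1,2)] by (simp add: sum_subtractf finite_multi_idx del: comp_apply)
  finally show ?thesis
    by (simp only: assms(4,5))
qed

section \<open>The reflection equation at consecutive shifts\<close>

lemma fps_central:
  fixes f :: "'a::ring_1 fps"
  assumes "\<And>k x. f $ k * x = x * f $ k"
  shows "f * g = g * f"
proof (rule fps_ext)
  fix n
  have "(f * g) $ n = (\<Sum>i = 0..n. g $ (n - i) * f $ i)"
    unfolding fps_mult_nth by (intro sum.cong refl assms)
  also have "\<dots> = (\<Sum>i = 0..n. g $ i * f $ (n - i))"
    by (rule sum.reindex_bij_witness[of _ "\<lambda>i. n - i" "\<lambda>i. n - i"]) auto
  finally show "(f * g) $ n = (g * f) $ n"
    by (simp add: fps_mult_nth)
qed

lemma scalar_fps_eq_fps_hom: "scalar_fps = fps_hom scalar"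
  by (simp add: fun_eq_iff scalar_fps_def fps_hom_def)

lemma is_ring_hom_scalar: "is_ring_hom (scalar :: complex \<Rightarrow> ('m::len0, 'l::len0) reflection_algebra)"
  by (simp add: is_ring_hom_def scalar_hom)

lemma is_ring_hom_scalar_fps: "is_ring_hom (scalar_fps :: _ \<Rightarrow> ('m::len0, 'l::len0) reflection_algebra fps)"
  unfolding scalar_fps_eq_fps_hom by (intro is_ring_hom_fps_hom is_ring_hom_scalar)

lemmas scalar_fps_simps = is_ring_hom_simps[OF is_ring_hom_scalar_fps]

lemma scalar_fps_central: "scalar_fps f * g = g * scalar_fps f"
  by (rule fps_central) (simp add: scalar_fps_def scalar_central)

lemma scalar_fps_X: "scalar_fps fps_X = fps_X"
  unfolding scalar_fps_eq_fps_hom by (rule fps_hom_simps[OF is_ring_hom_scalar])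

lemma scalar_fps_of_int: "scalar_fps (of_int k) = of_int k"
proof -
  have "scalar_fps (of_nat n) = of_nat n" for n
    by (induction n) (simp_all add: scalar_fps_simps)
  then show ?thesis
    by (cases k) (simp_all add: scalar_fps_simps del: of_nat_Suc)
qed

text \<open>A nonzero complex series is a unit times a power of the variable. The unit stays
  invertible under the embedding, and multiplication by a power of the variable only shifts
  coefficients.\<close>

lemma scalar_fps_mult_eq_0:
  fixes g :: "('m::len0, 'l::len0) reflection_algebra fps"
  assumes "f \<noteq> 0" "scalar_fps f * g = 0"
  shows "g = 0"
proof -
  define k where "k = subdegree f"
  define u where "u = fps_shift k f"
  have f: "f = u * fps_X ^ k"
    unfolding u_def k_def by (rule subdegree_decompose)
  have "u $ 0 \<noteq> 0"
    using assms(1) by (simp add: u_def k_def)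
  then have "fps_X ^ k = inverse u * f"
    unfolding f by (simp add: mult.assoc[symmetric] inverse_mult_eq_1)
  then have "scalar_fps (fps_X ^ k) * g = scalar_fps (inverse u) * (scalar_fps f * g)"
    by (simp add: scalar_fps_simps mult.assoc)
  then have "fps_X ^ k * g = 0"
    by (simp add: assms(2) scalar_fps_simps scalar_fps_X)
  then have "(fps_X ^ k * g) $ (i + k) = 0" for i
    by simp
  then show ?thesis
    by (simp add: fps_X_power_mult_nth fps_eq_iff)
qed

lemma two_mult_eq_0:
  fixes g :: "('m::len0, 'l::len0) reflection_algebra fps"
  assumes "2 * g = 0"
  shows "g = 0"
proof (rule scalar_fps_mult_eq_0[of 2])
  show "scalar_fps 2 * g = 0"
    using assms scalar_fps_of_int[of 2, where 'a = 'm and 'b = 'l] by simp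
qed simp

section \<open>Identities between reciprocals of linear functions\<close>

lemma inv_linear_mult:
  assumes "a \<noteq> 0"
  shows "inv_linear a c * (fps_const a + fps_const c * fps_X) = fps_X"
  using assms inverse_mult_eq_1[of "fps_const a + fps_const c * fps_X"]
  by (simp add: inv_linear_def mult.assoc)

lemma inv_linear_nonzero: "a \<noteq> 0 \<Longrightarrow> inv_linear a c \<noteq> 0"
  using inv_linear_mult[of a c] by auto

text \<open>The linear functions 2u + c and 2u + c - 1 differ by 1, so the difference of their
  reciprocals equals the product. Multiplying by the denominators reduces this to a polynomial
  identity.\<close>

lemma inv_linear_step: "inv_linear 2 c + inv_linear 2 (c - 1) * inv_linear 2 c = inv_linear 2 (c - 1)"
proof -
  define d e where "d = fps_const 2 + fps_const c * fps_X" and "e = fps_const 2 + fps_const (c - 1) * fps_X"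
  let ?I = "inv_linear 2 c" and ?J = "inv_linear 2 (c - 1)"
  have I: "?I * d = fps_X" and J: "?J * e = fps_X"
    unfolding d_def e_def by (simp_all add: inv_linear_mult)
  have de: "d = e + fps_X"
    by (simp add: d_def e_def algebra_simps flip: fps_const_sub)
  have "(?I + ?J * ?I) * (d * e) = (?I * d) * e + (?J * e) * (?I * d)"
    by (simp add: algebra_simps)
  also have "\<dots> = ?J * (d * e)"
    unfolding I using J de by (simp add: algebra_simps)
  finally have "(?I + ?J * ?I) * (d * e) = ?J * (d * e)" .
  moreover have "d * e \<noteq> 0"
    using I J by auto
  ultimately show ?thesis by simp
qed

text \<open>For the spectral parameters u - c and u - c - 1, with reciprocals \<open>x\<close> and
  \<open>y\<close>, the difference is 1 and the sum is 2u - 2c - 1. The two equations say this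
  without denominators.\<close>

lemma inv_linear_spectral:
  fixes c :: complex
  defines "x \<equiv> inv_linear 1 (- c)" and "y \<equiv> inv_linear 1 (- c - 1)"
  shows "y - x = x * y" "x * y = (x + y) * inv_linear 2 (- 2 * c - 1)"
proof -
  define d e where "d = fps_const 1 + fps_const (- c) * fps_X" and "e = fps_const 1 + fps_const (- c - 1) * fps_X"
  have x: "x * d = fps_X" and y: "y * e = fps_X"
    unfolding x_def y_def d_def e_def by (rule inv_linear_mult, simp)+
  have nz: "d * e \<noteq> 0"
    using x y by auto
  have de: "d = e + fps_X"
    by (simp add: d_def e_def algebra_simps flip: fps_const_sub fps_const_neg)
  have "(y - x) * (d * e) = (y * e) * d - (x * d) * e"
    by (simp add: algebra_simps)
  also have "\<dots> = (x * d) * (y * e)"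
    unfolding x y by (simp add: de algebra_simps)
  also have "\<dots> = (x * y) * (d * e)"
    by (simp add: algebra_simps)
  finally show "y - x = x * y"
    using nz by simp
  define w where "w = inv_linear 2 (- 2 * c - 1)"
  have de2: "d + e = fps_const 2 + fps_const (- 2 * c - 1) * fps_X"
    by (simp add: fps_eq_iff d_def e_def fps_numeral_nth fps_X_nth algebra_simps)
  have w: "w * (d + e) = fps_X"
    unfolding w_def de2 by (rule inv_linear_mult) simp
  have "(x + y) * w * (d * e) = ((x * d) * e + (y * e) * d) * w"
    by (simp add: algebra_simps)
  also have "\<dots> = (x * d) * (w * (d + e))"
    unfolding x y by (simp add: algebra_simps)
  also have "\<dots> = (x * d) * (y * e)"
    unfolding w y ..
  finally have "(x * y) * (d * e) = (x + y) * w * (d * e)"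
    by (simp add: algebra_simps)
  then show "x * y = (x + y) * inv_linear 2 (- 2 * c - 1)"
    using nz unfolding w_def by simp
qed

lemma is_ring_hom_abs_reflection_algebra:
  "is_ring_hom (abs_reflection_algebra :: _ \<Rightarrow> ('m::len0, 'l::len0) reflection_algebra)"
  by (simp add: is_ring_hom_def one_reflection_algebra_def plus_reflection_algebra.abs_eq
      times_reflection_algebra.abs_eq)

text \<open>Each coefficient of the defect of the free generators is a relator, and the quotient
  map, being a ring homomorphism, commutes with forming the defect.\<close>

lemma reflection_defect_b_gen:
  assumes n: "n = LENGTH('m::len0) + LENGTH('l::len0)"
    and pq: "p \<in> multi_idx n 2" "q \<in> multi_idx n 2"
  shows "reflection_defect n (b_gen :: _ \<Rightarrow> _ \<Rightarrow> _ \<Rightarrow> ('m, 'l) reflection_algebra) p q = 0"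
proof (intro fps_ext)
  fix r s
  let ?abs = "abs_reflection_algebra :: _ \<Rightarrow> ('m, 'l) reflection_algebra"
  let ?d = "reflection_defect n (\<lambda>i j r. free_gen (i, j, r)) p q $ r $ s"
  have "?d \<in> reflection_relators LENGTH('m) LENGTH('l)"
    using pq unfolding n reflection_relators_def Let_def by blast
  then have "?d - 0 \<in> two_sided_ideal (reflection_relators LENGTH('m) LENGTH('l))"
    using two_sided_ideal.gen[of ?d _ 1 1] by simp
  then have "?abs ?d = ?abs 0"
    by (simp add: reflection_algebra.abs_eq_iff)
  moreover have "?abs ?d = reflection_defect n b_gen p q $ r $ s"
    unfolding reflection_defect_hom[OF is_ring_hom_abs_reflection_algebra] b_gen.abs_eq ..
  ultimately show "reflection_defect n b_gen p q $ r $ s = (0 :: ('m, 'l) reflection_algebra fps fps) $ r $ s"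
    by (simp add: zero_reflection_algebra_def)
qed

section \<open>Passage from the defining relation to row operators\<close>

lemma row_at_mult: "row_at n i X (\<lambda>q. c * f q) = (\<lambda>q. c * row_at n i X f q)"
  by (rule ext) (simp add: row_at_def sum_distrib_left mult.assoc)

lemma row_R_mult:
  assumes "c * d = d * c"
  shows "row_R d i j (\<lambda>q. c * f q) = (\<lambda>q. c * row_R d i j f q)"
proof
  fix q
  have "d * (c * x) = c * (d * x)" for x
    using assms by (metis mult.assoc)
  then show "row_R d i j (\<lambda>q. c * f q) q = c * row_R d i j f q"
    unfolding row_R_def by (simp add: right_diff_distrib)
qed

text \<open>Freezing all entries of \<open>q\<close> except those at \<open>i\<close> and
  \<open>j\<close> makes a row vector on two tensor factors, on which the operators at 1 and 2 act
  as those at \<open>i\<close> and \<open>j\<close>.\<close>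

lemma row_at_pair:
  assumes "i \<noteq> j"
  shows "row_at n 1 X (\<lambda>p. f (q(i := p 1, j := p 2))) = (\<lambda>p. row_at n i X f (q(i := p 1, j := p 2)))"
    "row_at n 2 X (\<lambda>p. f (q(i := p 1, j := p 2))) = (\<lambda>p. row_at n j X f (q(i := p 1, j := p 2)))"
  using assms by (auto simp: row_at_def fun_upd_twist intro!: ext)

lemma row_R_pair:
  assumes "i \<noteq> j"
  shows "row_R c 1 2 (\<lambda>p. f (q(i := p 1, j := p 2))) = (\<lambda>p. row_R c i j f (q(i := p 1, j := p 2)))"
proof
  fix p :: "nat \<Rightarrow> nat"
  have "q(i := p 1, j := p 2) \<circ> Transposition.transpose i j = q(i := p 2, j := p 1)"
    using assms by (auto simp: fun_eq_iff Transposition.transpose_def)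
  then show "row_R c 1 2 (\<lambda>p. f (q(i := p 1, j := p 2))) p = row_R c i j f (q(i := p 1, j := p 2))"
    by (simp add: row_R_def)
qed

text \<open>Evaluating the cleared reflection equation at \<open>x\<close> = 1/(u - c) and
  \<open>y\<close> = 1/(u - c - 1) turns its R factors into \<open>e\<close> times 1 - P and
  \<open>d\<close> times 1 - w P. The central factor \<open>d * e\<close> then occurs on both sides
  and is cancelled.\<close>

lemma row_reflection_2:
  fixes f :: "(nat \<Rightarrow> nat) \<Rightarrow> ('m::len0, 'l::len0) reflection_algebra fps" and c :: nat
  assumes n: "n = LENGTH('m) + LENGTH('l)" and q: "q \<in> multi_idx n 2"
  defines "w \<equiv> scalar_fps (inv_linear 2 (- 2 * of_nat c - 1))"
  shows "row_at n 2 (b_shift (Suc c)) (row_R w 1 2 (row_at n 1 (b_shift c) (row_R 1 1 2 f))) q =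
    row_R 1 1 2 (row_at n 1 (b_shift c) (row_R w 1 2 (row_at n 2 (b_shift (Suc c)) f))) q"
proof -
  define x0 y0 where "x0 = inv_linear 1 (- of_nat c)" and "y0 = inv_linear 1 (- of_nat c - 1)"
  define x y :: "('m, 'l) reflection_algebra fps" where "x = scalar_fps x0" and "y = scalar_fps y0"
  define d e where "d = x + y" and "e = x * y"
  have yx: "y - x = e" and dw: "e = d * w"
    using inv_linear_spectral[of "of_nat c"]
    by (simp_all add: d_def e_def w_def x_def y_def x0_def y0_def flip: scalar_fps_simps)
  have ds: "d = scalar_fps (x0 + y0)" and es: "e = scalar_fps (x0 * y0)"
    by (simp_all add: d_def e_def x_def y_def scalar_fps_simps)
  have dc: "d * g = g * d" and ec: "e * g = g * e" for g
    unfolding ds es by (rule scalar_fps_central)+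
  define H where "H = fps_eval2 x y"
  have xy0: "x $ 0 = 0" "y $ 0 = 0"
    by (simp_all add: x_def y_def x0_def y0_def scalar_fps_def inv_linear_def scalar_hom)
  have "x * g = g * x" "y * g = g * y" for g
    unfolding x_def y_def by (rule scalar_fps_central)+
  note xyc = xy0 this
  have H: "is_ring_hom H"
    unfolding H_def by (rule is_ring_hom_fps_eval2[OF xyc])
  have H_X: "H fps_X = x" "H (fps_const fps_X) = y"
    unfolding H_def by (rule fps_eval2_X[OF xyc])+
  have y0_shift: "y0 = inv_linear 1 (- of_nat (Suc c))"
    \<comment> \<open>The spectral parameter shifted by one more unit is exactly the shift in
      \<open>b_shift (Suc c)\<close>.\<close>
    unfolding y0_def by (intro arg_cong[where f = "inv_linear 1"]) simp
  have b_x: "H (Abs_fps (\<lambda>r. fps_const (b_gen i j r))) = b_shift c i j" for i j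
    using fps_eval2_outer[OF xyc, of "Abs_fps (b_gen i j)"] by (simp add: H_def b_shift_def x_def x0_def)
  have b_y: "H (fps_const (Abs_fps (b_gen i j))) = b_shift (Suc c) i j" for i j
    using fps_eval2_const[OF xyc, of "Abs_fps (b_gen i j)"]
    by (simp only: H_def b_shift_def y_def y0_shift)
  let ?RM = "\<lambda>p q. e * tens_one p q - e * tens_swap 1 2 p q"
  let ?RP = "\<lambda>p q. d * tens_one p q - e * tens_swap 1 2 p q"
  let ?B1 = "tens_at 2 1 (b_shift c)" and ?B2 = "tens_at 2 2 (b_shift (Suc c))"
  have H_RM: "(\<lambda>p q. H ((fps_const fps_X - fps_X) * tens_one p q) - H (fps_X * fps_const fps_X * tens_swap 1 2 p q)) = ?RM"
    by (simp add: is_ring_hom_simps[OF H] H_X yx e_def[symmetric] tens_one_def tens_swap_def cong: if_cong)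
  have H_RP: "(\<lambda>p q. H ((fps_X + fps_const fps_X) * tens_one p q) - H (fps_X * fps_const fps_X * tens_swap 1 2 p q)) = ?RP"
    by (simp add: is_ring_hom_simps[OF H] H_X d_def[symmetric] e_def[symmetric] tens_one_def tens_swap_def cong: if_cong)
  have H_B1: "(\<lambda>p q. H (tens_at 2 1 (\<lambda>i j. Abs_fps (\<lambda>r. fps_const (b_gen i j r))) p q)) = ?B1"
    and H_B2: "(\<lambda>p q. H (tens_at 2 2 (\<lambda>i j. fps_const (Abs_fps (b_gen i j))) p q)) = ?B2"
    by (simp_all add: fun_eq_iff tens_at_def is_ring_hom_simps[OF H] b_x b_y cong: if_cong)
  have eq: "tens_prod n 2 [?RM, ?B1, ?RP, ?B2] p q = tens_prod n 2 [?B2, ?RP, ?B1, ?RM] p q"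
    if "p \<in> multi_idx n 2" for p
  proof -
    have "H (reflection_defect n b_gen p q) = 0"
      unfolding reflection_defect_b_gen[OF n that q] by (rule is_ring_hom_simps[OF H])
    then show ?thesis
      unfolding reflection_defect_def Let_def
      by (simp only: is_ring_hom_simps(6)[OF H] tens_prod_hom[OF H] list.map H_RM H_RP H_B1 H_B2 right_minus_eq)
  qed
  let ?TM = "\<lambda>f q. e * row_R 1 1 2 f q" and ?TP = "\<lambda>f q. d * row_R w 1 2 f q"
  let ?T1 = "row_at n 1 (b_shift c)" and ?T2 = "row_at n 2 (b_shift (Suc c))"
  have TM: "row_act n 2 f ?RM q = ?TM f q" and TP: "row_act n 2 f ?RP q = ?TP f q"
    and T1: "row_act n 2 f ?B1 q = ?T1 f q" and T2: "row_act n 2 f ?B2 q = ?T2 f q"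
    if "q \<in> multi_idx n 2" for f q
  proof -
    show "row_act n 2 f ?RM q = ?TM f q"
      using that by (subst row_act_one_minus_swap[OF _ _ _ ec ec]) (auto simp: row_R_def right_diff_distrib)
    show "row_act n 2 f ?RP q = ?TP f q"
      using that by (subst row_act_one_minus_swap[OF _ _ _ dc ec]) (auto simp: row_R_def right_diff_distrib dw mult.assoc)
    show "row_act n 2 f ?B1 q = ?T1 f q" "row_act n 2 f ?B2 q = ?T2 f q"
      using that by (auto intro: row_act_tens_at)
  qed
  \<comment> \<open>Each tensor is paired with its row operator, so that one application of
    \<open>row_act_tens_prod_map\<close> translates the whole product.\<close>
  have "fold snd [(?RM, ?TM), (?B1, ?T1), (?RP, ?TP), (?B2, ?T2)] f q =
      row_act n 2 f (tens_prod n 2 (map fst [(?RM, ?TM), (?B1, ?T1), (?RP, ?TP), (?B2, ?T2)])) q"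
    by (rule row_act_tens_prod_map[symmetric, OF _ q]) (auto simp: TM TP T1 T2 simp del: comp_apply)
  also have "\<dots> = row_act n 2 f (tens_prod n 2 (map fst [(?B2, ?T2), (?RP, ?TP), (?B1, ?T1), (?RM, ?TM)])) q"
    unfolding row_act_def list.map fst_conv by (intro sum.cong refl) (simp only: eq)
  also have "\<dots> = fold snd [(?B2, ?T2), (?RP, ?TP), (?B1, ?T1), (?RM, ?TM)] f q"
    by (rule row_act_tens_prod_map[OF _ q]) (auto simp: TM TP T1 T2 simp del: comp_apply)
  finally have "?T2 (?TP (?T1 (?TM f))) q = ?TM (?T1 (?TP (?T2 f))) q"
    by simp
  then have "d * (e * (?T2 (row_R w 1 2 (?T1 (row_R 1 1 2 f))) q)) =
      e * (d * row_R 1 1 2 (?T1 (row_R w 1 2 (?T2 f))) q)"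
    by (simp only: row_at_mult row_R_mult[OF ec] row_R_mult[OF dc])
  then have de0: "d * e * (?T2 (row_R w 1 2 (?T1 (row_R 1 1 2 f))) q - row_R 1 1 2 (?T1 (row_R w 1 2 (?T2 f))) q) = 0"
    by (simp only: right_diff_distrib mult.assoc[symmetric] ec[of d] right_minus_eq)
  have de: "d * e = scalar_fps ((x0 + y0) * (x0 * y0))"
    by (simp add: ds es scalar_fps_simps)
  \<comment> \<open>The nonzero product \<open>x0 * y0\<close> is a multiple of
    \<open>x0 + y0\<close>, so the latter is nonzero as well.\<close>
  have "(x0 + y0) * (x0 * y0) \<noteq> 0"
    using inv_linear_spectral(2)[of "of_nat c"] inv_linear_nonzero[of 1]
    by (auto simp: x0_def y0_def)
  from scalar_fps_mult_eq_0[OF this de0[unfolded de]] show ?thesis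
    by (simp only: right_minus_eq)
qed

lemma row_reflection:
  fixes f :: "(nat \<Rightarrow> nat) \<Rightarrow> ('m::len0, 'l::len0) reflection_algebra fps" and c :: nat
  assumes n: "n = LENGTH('m) + LENGTH('l)" and q: "q \<in> multi_idx n n"
    and i: "i \<in> {1..n}" and j: "j \<in> {1..n}" and ij: "i \<noteq> j"
  defines "w \<equiv> scalar_fps (inv_linear 2 (- 2 * of_nat c - 1))"
  shows "row_at n j (b_shift (Suc c)) (row_R w i j (row_at n i (b_shift c) (row_R 1 i j f))) q =
    row_R 1 i j (row_at n i (b_shift c) (row_R w i j (row_at n j (b_shift (Suc c)) f))) q"
proof -
  \<comment> \<open>The two entries of \<open>q\<close> on which the operators act; the others are
    frozen.\<close>
  define p where "p = restrict (\<lambda>t::nat. if t = 1 then q i else q j) {1..2}"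
  have p: "p \<in> multi_idx n 2"
    using multi_idx_apply[OF q i] multi_idx_apply[OF q j] by (auto simp: p_def multi_idx_def)
  have lift: "q(i := p 1, j := p 2) = q"
    by (auto simp: p_def)
  show ?thesis
    using row_reflection_2[OF n p, where f = "\<lambda>p. f (q(i := p 1, j := p 2))" and c = c]
    unfolding row_at_pair[OF ij] row_R_pair[OF ij] lift w_def .
qed

section \<open>Cycles of an index map\<close>

lemma finite_fibre: "finite (fibre n \<eta> N)"
  by (simp add: fibre_def)

lemma mem_cycle_minima_iff:
  assumes "k \<in> {1..n}"
  shows "k \<in> cycle_minima n \<eta> \<longleftrightarrow> (\<forall>k'\<in>{1..<k}. \<eta> k' \<noteq> \<eta> k)"
proof
  assume "k \<in> cycle_minima n \<eta>"
  then obtain j where j: "j \<in> {1..n}" "k = Min (fibre n \<eta> (\<eta> j))"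
    by (auto simp: cycle_minima_def)
  have "j \<in> fibre n \<eta> (\<eta> j)"
    using j by (simp add: fibre_def)
  then have "k \<in> fibre n \<eta> (\<eta> j)"
    unfolding j(2) using finite_fibre Min_in by blast
  then have k: "\<eta> k = \<eta> j"
    by (simp add: fibre_def)
  show "\<forall>k'\<in>{1..<k}. \<eta> k' \<noteq> \<eta> k"
  proof (intro ballI notI)
    fix k' assume k': "k' \<in> {1..<k}" "\<eta> k' = \<eta> k"
    then have "k' \<in> fibre n \<eta> (\<eta> j)"
      using assms k by (simp add: fibre_def)
    then have "k \<le> k'"
      unfolding j(2) by (intro Min_le finite_fibre)
    then show False using k' by simp
  qed
next
  assume *: "\<forall>k'\<in>{1..<k}. \<eta> k' \<noteq> \<eta> k"
  have "Min (fibre n \<eta> (\<eta> k)) = k"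
  proof (intro Min_eqI finite_fibre)
    show "k \<le> y" if "y \<in> fibre n \<eta> (\<eta> k)" for y
    proof (rule ccontr)
      assume "\<not> k \<le> y"
      then have "y \<in> {1..<k}" "\<eta> y = \<eta> k" using that by (simp_all add: fibre_def)
      then show False using * by blast
    qed
  qed (use assms in \<open>simp add: fibre_def\<close>)
  then show "k \<in> cycle_minima n \<eta>"
    unfolding cycle_minima_def using assms by (intro image_eqI[of k _ "\<eta> k"] imageI) auto
qed

lemma mem_cycle_maxima_iff:
  assumes "k \<in> {1..n}"
  shows "k \<in> cycle_maxima n \<eta> \<longleftrightarrow> \<not> (\<exists>k'. k < k' \<and> k' \<le> n \<and> \<eta> k' = \<eta> k)"
proof
  assume "k \<in> cycle_maxima n \<eta>"
  then obtain j where j: "j \<in> {1..n}" "k = Max (fibre n \<eta> (\<eta> j))"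
    by (auto simp: cycle_maxima_def)
  have "j \<in> fibre n \<eta> (\<eta> j)"
    using j by (simp add: fibre_def)
  then have "k \<in> fibre n \<eta> (\<eta> j)"
    unfolding j(2) using finite_fibre Max_in by blast
  then have k: "\<eta> k = \<eta> j"
    by (simp add: fibre_def)
  show "\<not> (\<exists>k'. k < k' \<and> k' \<le> n \<and> \<eta> k' = \<eta> k)"
  proof
    assume "\<exists>k'. k < k' \<and> k' \<le> n \<and> \<eta> k' = \<eta> k"
    then obtain k' where k': "k < k'" "k' \<le> n" "\<eta> k' = \<eta> k" by blast
    then have "k' \<in> fibre n \<eta> (\<eta> j)"
      using assms k by (simp add: fibre_def)
    then have "k' \<le> k"
      unfolding j(2) by (intro Max_ge finite_fibre)
    then show False using k' by simp
  qed
next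
  assume *: "\<not> (\<exists>k'. k < k' \<and> k' \<le> n \<and> \<eta> k' = \<eta> k)"
  have "Max (fibre n \<eta> (\<eta> k)) = k"
  proof (intro Max_eqI finite_fibre)
    show "y \<le> k" if "y \<in> fibre n \<eta> (\<eta> k)" for y
    proof (rule ccontr)
      assume "\<not> y \<le> k"
      then have "k < y \<and> y \<le> n \<and> \<eta> y = \<eta> k" using that by (simp add: fibre_def)
      then show False using * by blast
    qed
  qed (use assms in \<open>simp add: fibre_def\<close>)
  then show "k \<in> cycle_maxima n \<eta>"
    unfolding cycle_maxima_def using assms by (intro image_eqI[of k _ "\<eta> k"] imageI) auto
qed

lemma cycle_of_list_nth:
  assumes "distinct xs" "Suc i < length xs"
  shows "cycle_of_list xs (xs ! i) = xs ! Suc i"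
proof -
  have "map (cycle_of_list xs) xs = rotate1 xs"
    using cyclic_rotation[OF assms(1), of 1] by (simp add: One_nat_def)
  then have "map (cycle_of_list xs) xs ! i = rotate1 xs ! i" by simp
  then show ?thesis
    using assms(2) by (simp add: nth_rotate1)
qed

text \<open>The fibres are disjoint and each cycle maps its own fibre to itself, so among all the
  cycles only that of the fibre of \<open>k\<close> moves \<open>k\<close>.\<close>

lemma cycle_perm_eq_cycle_of_list:
  assumes k: "k \<in> {1..n}"
  shows "cycle_perm n \<eta> k = cycle_of_list (sorted_list_of_set (fibre n \<eta> (\<eta> k))) k"
proof -
  let ?C = "\<lambda>N. cycle_of_list (sorted_list_of_set (fibre n \<eta> N))"
  have out: "?C N x = x" if "x \<notin> fibre n \<eta> N" for N x
    using that by (intro id_outside_supp) (simp add: finite_fibre)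
  have inC: "?C N x \<in> fibre n \<eta> N" if "x \<in> fibre n \<eta> N" for N x
  proof -
    have "?C N permutes fibre n \<eta> N"
      using cycle_permutes[of "sorted_list_of_set (fibre n \<eta> N)"] by (simp add: finite_fibre)
    then show ?thesis using that by (simp add: permutes_in_image)
  qed
  have kf: "k \<in> fibre n \<eta> (\<eta> k)" using k by (simp add: fibre_def)
  have "foldr (\<lambda>N \<pi>. ?C N \<circ> \<pi>) Ns id k = (if \<eta> k \<in> set Ns then ?C (\<eta> k) k else k)" if "distinct Ns" for Ns
    using that
  proof (induction Ns)
    case (Cons N Ns)
    show ?case
    proof (cases "N = \<eta> k")
      case True
      then show ?thesis using Cons by simp
    next
      case False
      then have "?C (\<eta> k) k \<notin> fibre n \<eta> N" "k \<notin> fibre n \<eta> N"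
        using inC[OF kf] by (auto simp: fibre_def)
      then show ?thesis using Cons False out[of _ N] by simp
    qed
  qed simp
  from this[of "sorted_list_of_set (\<eta> ` {1..n})"] show ?thesis
    using k by (simp add: cycle_perm_def)
qed

text \<open>In the increasing list of a fibre the cycle takes an entry to the next one. This links
  the cycles to the successor in \<open>row_at_path\<close>.\<close>

lemma cycle_perm_eq_Least:
  assumes k: "k \<in> {1..n}" and ex: "\<exists>k'. k < k' \<and> k' \<le> n \<and> \<eta> k' = \<eta> k"
  shows "cycle_perm n \<eta> k = (LEAST k'. k < k' \<and> \<eta> k' = \<eta> k)"
proof -
  define L where "L = sorted_list_of_set (fibre n \<eta> (\<eta> k))"
  have L: "sorted_wrt (<) L" "distinct L" "set L = fibre n \<eta> (\<eta> k)"
    unfolding L_def by (simp_all add: finite_fibre)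
  have "k \<in> set L" using k unfolding L(3) by (simp add: fibre_def)
  then obtain i where i: "i < length L" "L ! i = k"
    by (auto simp: in_set_conv_nth)
  obtain k' where k': "k < k'" "k' \<le> n" "\<eta> k' = \<eta> k" using ex by blast
  have later: "\<exists>j. i < j \<and> j < length L \<and> y = L ! j" if "k < y" "y \<le> n" "\<eta> y = \<eta> k" for y
  proof -
    have "y \<in> set L" using that unfolding L(3) by (simp add: fibre_def)
    then obtain j where j: "j < length L" "L ! j = y"
      by (auto simp: in_set_conv_nth)
    have "\<not> j \<le> i"
    proof
      assume "j \<le> i"
      then have "L ! j \<le> L ! i"
        using sorted_nth_mono[of L j i] L(1) i by (simp add: strict_sorted_iff)
      then show False using i j that by simp
    qed
    then show ?thesis using j by (intro exI[of _ j]) simp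
  qed
  from later[OF k'] have Si: "Suc i < length L" by auto
  have "L ! Suc i \<in> fibre n \<eta> (\<eta> k)"
    using nth_mem[OF Si] unfolding L(3) .
  then have fib: "\<eta> (L ! Suc i) = \<eta> k" "L ! Suc i \<le> n" by (simp_all add: fibre_def)
  have "(LEAST k'. k < k' \<and> \<eta> k' = \<eta> k) = L ! Suc i"
  proof (rule Least_equality)
    show "k < L ! Suc i \<and> \<eta> (L ! Suc i) = \<eta> k"
      using sorted_wrt_nth_less[OF L(1), of i "Suc i"] Si i(2) fib by simp
  next
    fix y assume y: "k < y \<and> \<eta> y = \<eta> k"
    show "L ! Suc i \<le> y"
    proof (cases "y \<le> n")
      case True
      then obtain j where "i < j" "j < length L" "y = L ! j" using later[of y] y by blast
      then show ?thesis
        using sorted_nth_mono[of L "Suc i" j] L(1) by (simp add: strict_sorted_iff)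
    next
      \<comment> \<open>\<open>LEAST\<close> is not bounded by \<open>n\<close>, whereas
        \<open>fibre\<close> is. A candidate beyond \<open>n\<close> exceeds every element of the
        fibre.\<close>
      case False
      then show ?thesis using fib by simp
    qed
  qed
  then show ?thesis
    unfolding cycle_perm_eq_cycle_of_list[OF k] L_def[symmetric]
    using cycle_of_list_nth[OF L(2) Si] i(2) by simp
qed

section \<open>The expansion\<close>

abbreviation (input) R_weight :: "nat \<Rightarrow> ('m::len0, 'l::len0) reflection_algebra fps" where
  "R_weight s \<equiv> scalar_fps (inv_linear 2 (2 - of_nat s))"

abbreviation (input) b_row :: "nat \<Rightarrow> nat \<Rightarrow> nat \<Rightarrow> ('m::len0, 'l::len0) reflection_algebra fps" where
  "b_row k \<equiv> b_shift (k - 1)"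

lemma R_weights_R_weight: "R_weights (R_weight :: _ \<Rightarrow> ('m::len0, 'l::len0) reflection_algebra fps)"
proof
  show "R_weight a * x = x * R_weight a" for a and x :: "('m, 'l) reflection_algebra fps"
    by (rule scalar_fps_central)
  have "(2 - of_nat a :: complex) - 1 = 2 - of_nat (Suc a)" for a
    by simp
  then show "R_weight a + R_weight (Suc a) * R_weight a = (R_weight (Suc a) :: ('m, 'l) reflection_algebra fps)" for a
    using inv_linear_step[of "2 - of_nat a"] by (metis scalar_fps_simps(2,3))
qed

lemma row_act_bracket:
  fixes f :: "(nat \<Rightarrow> nat) \<Rightarrow> ('m::len0, 'l::len0) reflection_algebra fps"
  assumes "q \<in> multi_idx n n"
  shows "row_act n n f (bracket n) q = fold (row_block n b_row R_weight) [1..<n + 1] f q"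
  unfolding bracket_def
proof (rule row_act_tens_prod_concat[OF _ assms])
  fix i q and f :: "(nat \<Rightarrow> nat) \<Rightarrow> ('m::len0, 'l::len0) reflection_algebra fps"
  assume i: "i \<in> set [1..<n + 1]" and q: "q \<in> multi_idx n n"
  have R: "row_act n n f (R_op i j) q = row_R (R_weight (i + j)) i j f q"
    if "j \<in> set [i + 1..<n + 1]" "q \<in> multi_idx n n"
    for j q and f :: "(nat \<Rightarrow> nat) \<Rightarrow> ('m::len0, 'l::len0) reflection_algebra fps"
  proof -
    have "(R_op i j :: ('m, 'l) reflection_algebra fps tens) = (\<lambda>p q. 1 * tens_one p q - R_weight (i + j) * tens_swap i j p q)"
      by (intro ext) (simp add: R_op_def diff_diff_eq)
    moreover have "row_act n n f (\<lambda>p q. 1 * tens_one p q - R_weight (i + j) * tens_swap i j p q) q =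
        1 * f q - R_weight (i + j) * f (q \<circ> Transposition.transpose i j)"
      by (rule row_act_one_minus_swap) (use i that in \<open>auto simp: scalar_fps_central\<close>)
    ultimately show ?thesis
      by (simp add: row_R_def)
  qed
  have "row_act n n f (tens_prod n n (tens_at n i (b_row i) # map (R_op i) [i + 1..<n + 1])) q =
      row_act n n (row_at n i (b_row i) f) (tens_prod n n (map (R_op i) [i + 1..<n + 1])) q"
    unfolding row_act_tens_prod_Cons by (rule row_act_cong, rule row_act_tens_at) (use i in auto)
  also have "\<dots> = row_block n b_row R_weight i f q"
    unfolding row_block_def row_Rs_def by (rule row_act_tens_prod_map[OF R q])
  finally show "row_act n n f (tens_prod n n (tens_at n i (b_row i) # map (R_op i) [i + 1..<n + 1])) q =
      row_block n b_row R_weight i f q" .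
qed

text \<open>The difference of the two sides is alternating and vanishes at the identity, where the
  row of the antisymmetrizer has entry 1.\<close>

lemma alternating_eq_antisymmetrizer:
  fixes g :: "(nat \<Rightarrow> nat) \<Rightarrow> 'r::ring_1"
  assumes g: "\<And>i. i \<in> {1..<n} \<Longrightarrow> alternating n n i (Suc i) g"
    and two: "\<And>x::'r. 2 * x = 0 \<Longrightarrow> x = 0" and q: "q \<in> multi_idx n n"
  shows "g q = g (restrict id {1..n}) * antisymmetrizer n (restrict id {1..n}) q"
proof -
  let ?e = "restrict id {1..n}"
  define h where "h q = g q - g ?e * antisymmetrizer n ?e q" for q
  have "h q = 0"
  proof (rule alternating_eq_zero[OF _ two _ q])
    show "alternating n n i (Suc i) h" if "i \<in> {1..<n}" for i
    proof -
      have "alternating n n i (Suc i) (antisymmetrizer n ?e :: _ \<Rightarrow> 'r)"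
        using that by (intro antisymmetrizer_alternating) auto
      then show ?thesis
        using g[OF that] unfolding alternating_def h_def by (simp del: comp_apply)
    qed
    have "antisymmetrizer n ?e ?e = (1 :: 'r)"
      using antisymmetrizer_id[OF permutes_id, of n] by (simp add: sign_id del: restrict_apply)
    then show "h ?e = 0"
      by (simp add: h_def del: restrict_apply)
  qed
  then show ?thesis by (simp add: h_def)
qed

lemma antisymmetrizer_central: "antisymmetrizer n p q * x = x * antisymmetrizer n p q"
  unfolding antisymmetrizer_def sum_distrib_left sum_distrib_right
  by (intro sum.cong refl) (simp add: mult_of_int_commute)

text \<open>Every row of the antisymmetrizer is a multiple of the row at the identity, so it
  suffices to follow that row through the bracket. The result is alternating, hence again a multiple
  of the row. Uniqueness holds because the antisymmetrizer has entry 1 at the identity.\<close>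

lemma sdet_eq_fold_row_block:
  fixes n :: nat
  assumes n: "n = LENGTH('m::len0) + LENGTH('l::len0)"
  shows "(sdet :: ('m, 'l) reflection_algebra fps) =
    fold (row_block n b_row R_weight) [1..<n + 1] (antisymmetrizer n (restrict id {1..n})) (restrict id {1..n})"
proof -
  interpret R_weights "R_weight :: _ \<Rightarrow> ('m, 'l) reflection_algebra fps"
    by (rule R_weights_R_weight)
  let ?e = "restrict id {1..n}"
  let ?A = "antisymmetrizer n :: ('m, 'l) reflection_algebra fps tens"
  define g where "g = fold (row_block n b_row R_weight) [1..<n + 1] (?A ?e)"
  note two = two_mult_eq_0[where 'm = 'm and 'l = 'l]
  have alt_A: "alternating n n i (Suc i) (?A p)" if "i \<in> {1..<n}" for i p
    using that by (intro antisymmetrizer_alternating) auto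
  have A: "?A p q = ?A p ?e * ?A ?e q" if "q \<in> multi_idx n n" for p q
    by (rule alternating_eq_antisymmetrizer[OF alt_A two that])
  have "alternating n n i (Suc i) g" if i: "i \<in> {1..<n}" for i
    unfolding g_def
  proof (rule alternating_fold_row_block[OF alt_A[OF i] _ _ two])
    show "1 \<le> i" "Suc i \<le> n" using i by auto
    fix f :: "_ \<Rightarrow> ('m, 'l) reflection_algebra fps" and q
    assume q: "q \<in> multi_idx n n"
    \<comment> \<open>With \<open>c = i - 1\<close> the weight in the reflection equation becomes
      1/(2u + 2 - (2i + 1)), the weight of R on the legs \<open>i\<close> and
      \<open>Suc i\<close>.\<close>
    have "(- 2 * of_nat (i - 1) - 1 :: complex) = 2 - of_nat (i + Suc i)"
      using i by (simp add: of_nat_diff)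
    then show "row_at n (Suc i) (b_row (Suc i)) (row_R (R_weight (i + Suc i)) i (Suc i) (row_at n i (b_row i) (row_R 1 i (Suc i) f))) q =
        row_R 1 i (Suc i) (row_at n i (b_row i) (row_R (R_weight (i + Suc i)) i (Suc i) (row_at n (Suc i) (b_row (Suc i)) f))) q"
      using row_reflection[OF n q, of i "Suc i" "i - 1" f] i by simp
  qed
  then have g: "g q = g ?e * ?A ?e q" if "q \<in> multi_idx n n" for q
    by (rule alternating_eq_antisymmetrizer[OF _ two that])
  have ex: "tens_mult n n ?A (bracket n) p q = g ?e * ?A p q" if q: "q \<in> multi_idx n n" for p q
  proof -
    have "tens_mult n n ?A (bracket n) p q = row_act n n (?A p) (bracket n) q"
      by (simp only: tens_mult_def row_act_def)
    also have "\<dots> = row_act n n (\<lambda>r. ?A p ?e * ?A ?e r) (bracket n) q"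
      by (rule row_act_cong) (rule A)
    also have "\<dots> = ?A p ?e * row_act n n (?A ?e) (bracket n) q"
      by (simp only: row_act_def sum_distrib_left mult.assoc)
    also have "row_act n n (?A ?e) (bracket n) q = g ?e * ?A ?e q"
      unfolding row_act_bracket[OF q] g_def[symmetric] by (rule g[OF q])
    also have "?A p ?e * (g ?e * ?A ?e q) = (?A p ?e * g ?e) * ?A ?e q"
      by (simp only: mult.assoc)
    also have "?A p ?e * g ?e = g ?e * ?A p ?e"
      by (rule antisymmetrizer_central)
    finally show ?thesis
      by (simp only: mult.assoc A[OF q, symmetric])
  qed
  have "?A ?e ?e = 1"
    using antisymmetrizer_id[OF permutes_id, of n] by (simp add: sign_id del: restrict_apply)
  show ?thesis
    unfolding sdet_def Let_def n[symmetric] g_def[symmetric]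
  proof (rule the_equality)
    show "\<forall>p\<in>multi_idx n n. \<forall>q\<in>multi_idx n n. tens_mult n n ?A (bracket n) p q = g ?e * ?A p q"
      using ex by blast
    fix s
    assume "\<forall>p\<in>multi_idx n n. \<forall>q\<in>multi_idx n n. tens_mult n n ?A (bracket n) p q = s * ?A p q"
    then have "s * ?A ?e ?e = g ?e * ?A ?e ?e"
      using ex multi_idx_self by metis
    then show "s = g ?e"
      unfolding \<open>?A ?e ?e = 1\<close> by simp
  qed
qed

lemma row_act_b_coeff:
  fixes f :: "(nat \<Rightarrow> nat) \<Rightarrow> ('m::len0, 'l::len0) reflection_algebra fps"
  assumes "\<And>k. k \<in> {1..n} \<Longrightarrow> \<eta> k \<in> {1..n}" "q \<in> multi_idx n n"
  shows "row_act n n f (b_coeff n \<eta>) q = fold (\<lambda>k. row_at n (\<eta> k) (b_row k)) [1..<n + 1] f q"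
  unfolding b_coeff_def
  by (rule row_act_tens_prod_map[OF row_act_tens_at assms(2)]) (use assms(1) in auto)

text \<open>The case \<open>m = n\<close> of \<open>row_at_path\<close>. The condition on positions
  outside the image of \<open>\<eta>\<close> says that \<open>\<sigma>\<close> fixes them, and being
  first or not last in a fibre translates into the minima, maxima and successors of the
  cycles.\<close>

lemma b_coeff_path:
  fixes n :: nat
  assumes \<eta>: "\<And>k. k \<in> {1..n} \<Longrightarrow> \<eta> k \<in> {1..n}" and \<sigma>: "\<sigma> permutes {1..n}"
  shows "(b_coeff n \<eta> (restrict \<sigma> {1..n}) (restrict id {1..n}) :: ('m::len0, 'l::len0) reflection_algebra fps) =
    (if \<sigma> \<in> image_perms n \<eta>
     then \<Sum>s\<in>summation_idx n \<eta>. \<Prod>k\<leftarrow>[1..<n + 1]. b_shift (k - 1) (lower_idx n \<eta> \<sigma> s k) (upper_idx n \<eta> s k)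
     else 0)"
proof -
  let ?p = "restrict \<sigma> {1..n}" and ?e = "restrict id {1..n}"
  define fresh where "fresh k \<longleftrightarrow> (\<forall>k'\<in>{1..<k}. \<eta> k' \<noteq> \<eta> k)" for k
  define lo where "lo s k = (if fresh k then ?p (\<eta> k) else s k)" for s k
  define up where "up s k = (if \<exists>k'. k < k' \<and> k' \<le> n \<and> \<eta> k' = \<eta> k
      then s (LEAST k'. k < k' \<and> \<eta> k' = \<eta> k) else ?e (\<eta> k))" for s k
  have p: "?p \<in> multi_idx n n"
    unfolding multi_idx_def restrict_PiE_iff using permutes_in_image[OF \<sigma>] by blast
  have "(b_coeff n \<eta> ?p ?e :: ('m, 'l) reflection_algebra fps) = fold (\<lambda>k. row_at n (\<eta> k) (b_row k)) [1..<n + 1] (tens_one ?p) ?e"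
    \<comment> \<open>A matrix coefficient is an entry of the tensor applied to a basis row
      vector.\<close>
    by (subst row_act_b_coeff[OF \<eta> multi_idx_self, symmetric]) (simp_all only: row_act_tens_one(2)[OF p])
  also have "\<dots> = (if \<forall>N\<in>{1..n} - \<eta> ` {1..n}. ?p N = ?e N
     then \<Sum>s\<in>{k\<in>{1..n}. \<not> fresh k} \<rightarrow>\<^sub>E {1..n}. \<Prod>k\<leftarrow>[1..<n + 1]. b_row k (lo s k) (up s k)
     else 0)"
    unfolding fresh_def lo_def up_def by (rule row_at_path[OF \<eta> p order_refl multi_idx_self])
  also have "(\<forall>N\<in>{1..n} - \<eta> ` {1..n}. ?p N = ?e N) \<longleftrightarrow> \<sigma> \<in> image_perms n \<eta>"
    using \<sigma> by (simp add: image_perms_def)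
  also have "{k\<in>{1..n}. \<not> fresh k} \<rightarrow>\<^sub>E {1..n} = summation_idx n \<eta>"
    unfolding summation_idx_def fresh_def
    by (intro arg_cong2[where f = PiE] refl) (use mem_cycle_minima_iff[of _ n \<eta>] in blast)
  finally have sum: "(b_coeff n \<eta> ?p ?e :: ('m, 'l) reflection_algebra fps) = (if \<sigma> \<in> image_perms n \<eta>
     then \<Sum>s\<in>summation_idx n \<eta>. \<Prod>k\<leftarrow>[1..<n + 1]. b_row k (lo s k) (up s k)
     else 0)" .
  have path: "(\<Prod>k\<leftarrow>[1..<n + 1]. b_row k (lo s k) (up s k) :: ('m, 'l) reflection_algebra fps) =
      (\<Prod>k\<leftarrow>[1..<n + 1]. b_row k (lower_idx n \<eta> \<sigma> s k) (upper_idx n \<eta> s k))" for s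
  proof (intro arg_cong[where f = prod_list] map_cong refl)
    fix k assume "k \<in> set [1..<n + 1]"
    then have k: "k \<in> {1..n}" by auto
    have "lo s k = lower_idx n \<eta> \<sigma> s k"
      using \<eta>[OF k] unfolding lo_def fresh_def lower_idx_def mem_cycle_minima_iff[OF k] by simp
    moreover have "up s k = upper_idx n \<eta> s k"
    proof (cases "\<exists>k'. k < k' \<and> k' \<le> n \<and> \<eta> k' = \<eta> k")
      case True
      then show ?thesis
        unfolding up_def upper_idx_def mem_cycle_maxima_iff[OF k] cycle_perm_eq_Least[OF k True]
        by (simp only: if_True if_False not_True_eq_False)
    next
      case False
      then show ?thesis
        unfolding up_def upper_idx_def mem_cycle_maxima_iff[OF k] using \<eta>[OF k]
        by (simp only: if_True if_False not_False_eq_True restrict_apply id_apply)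
    qed
    ultimately show "b_row k (lo s k) (up s k) = b_row k (lower_idx n \<eta> \<sigma> s k) (upper_idx n \<eta> s k)"
      by simp
  qed
  show ?thesis
    unfolding sum path ..
qed

theorem theorem1:
  fixes n :: nat
  assumes "n = LENGTH('m::len0) + LENGTH('l::len0)"
  shows "(sdet :: ('m, 'l) reflection_algebra fps) =
      (\<Sum>\<eta>\<in>index_maps n. \<Sum>\<sigma>\<in>image_perms n \<eta>.
        scalar_fps (sdet_weight n \<sigma> \<eta>) * b_coeff n \<eta> (restrict \<sigma> {1..n}) (restrict id {1..n})) \<and>
    (\<forall>\<eta>\<in>index_maps n. \<forall>\<sigma>\<in>image_perms n \<eta>.
      (b_coeff n \<eta> (restrict \<sigma> {1..n}) (restrict id {1..n}) :: ('m, 'l) reflection_algebra fps) =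
        (\<Sum>s\<in>summation_idx n \<eta>.
          \<Prod>k\<leftarrow>[1..<n + 1]. b_shift (k - 1) (lower_idx n \<eta> \<sigma> s k) (upper_idx n \<eta> s k)))"
proof (intro conjI ballI)
  interpret R_weights "R_weight :: _ \<Rightarrow> ('m, 'l) reflection_algebra fps"
    by (rule R_weights_R_weight)
  let ?e = "restrict id {1..n}"
  let ?\<epsilon> = "antisymmetrizer n ?e :: _ \<Rightarrow> ('m, 'l) reflection_algebra fps"
  have \<eta>: "\<eta> k \<in> {1..n}" if "\<eta> \<in> index_maps n" "k \<in> {1..n}" for \<eta> k
    using PiE_mem[OF that[unfolded index_maps_def]] that(2) by auto
  have perms: "image_perms n \<eta> \<subseteq> {\<sigma>. \<sigma> permutes {1..n}}" for \<eta>
    by (auto simp: image_perms_def)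
  let ?W = "\<lambda>\<eta>. \<Prod>i | i \<in> {1..n} \<and> i < \<eta> i. inv_linear 2 (2 - of_nat (i + n))"
  let ?b = "\<lambda>\<eta> \<sigma>. b_coeff n \<eta> (restrict \<sigma> {1..n}) ?e :: ('m, 'l) reflection_algebra fps"
  have summand: "fold (\<lambda>k. row_at n (\<eta> k) (b_row k)) [1..<n + 1] ?\<epsilon> ?e =
      (\<Sum>\<sigma>\<in>image_perms n \<eta>. of_int (sign \<sigma>) * ?b \<eta> \<sigma>)" if "\<eta> \<in> index_maps n" for \<eta>
  proof -
    have "fold (\<lambda>k. row_at n (\<eta> k) (b_row k)) [1..<n + 1] ?\<epsilon> ?e = row_act n n ?\<epsilon> (b_coeff n \<eta>) ?e"
      by (rule row_act_b_coeff[symmetric, OF \<eta>[OF that] multi_idx_self])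
    also have "\<dots> = (\<Sum>\<sigma> | \<sigma> permutes {1..n}. of_int (sign \<sigma>) * ?b \<eta> \<sigma>)"
      unfolding row_act_def by (rule antisymmetrizer_sum)
    also have "\<dots> = (\<Sum>\<sigma>\<in>image_perms n \<eta>. of_int (sign \<sigma>) * ?b \<eta> \<sigma>)"
    \<comment> \<open>Antisymmetrization sums over all permutations; those moving a point outside
      the image of \<open>\<eta>\<close> have coefficient zero by \<open>b_coeff_path\<close>, which
      leaves the subgroup S(\<eta>).\<close>
    proof (intro sum.mono_neutral_right perms ballI)
      fix \<sigma> assume "\<sigma> \<in> {\<sigma>. \<sigma> permutes {1..n}} - image_perms n \<eta>"
      then have "?b \<eta> \<sigma> = 0"
        using b_coeff_path[of n \<eta> \<sigma>, OF \<eta>[OF that], where 'm = 'm and 'l = 'l] by simp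
      then show "of_int (sign \<sigma>) * ?b \<eta> \<sigma> = 0" by simp
    qed (simp add: finite_permutations)
    finally show ?thesis .
  qed
  have weight: "scalar_fps (?W \<eta>) * (of_int (sign \<sigma>) * x) = scalar_fps (sdet_weight n \<sigma> \<eta>) * x"
    for \<eta> \<sigma> and x :: "('m, 'l) reflection_algebra fps"
  proof -
    have "sdet_weight n \<sigma> \<eta> = ?W \<eta> * of_int (sign \<sigma>)"
      unfolding sdet_weight_def by (simp add: diff_diff_eq mult.commute)
    then show ?thesis
      by (simp add: scalar_fps_simps scalar_fps_of_int mult.assoc)
  qed
  \<comment> \<open>Blocks are replaced by the operators Z, whose product is then expanded over
    \<open>\<eta>\<close>.\<close>
  have "(sdet :: ('m, 'l) reflection_algebra fps) = fold (row_Z n b_row R_weight) [1..<n + 1] ?\<epsilon> ?e"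
    unfolding sdet_eq_fold_row_block[OF assms]
    by (rule fold_row_block_eq_fold_row_Z[OF antisymmetrizer_alternating order_refl multi_idx_self])
  also have "\<dots> = (\<Sum>\<eta>\<in>index_maps n. scalar_fps (?W \<eta>) *
      fold (\<lambda>k. row_at n (\<eta> k) (b_row k)) [1..<n + 1] ?\<epsilon> ?e)"
    unfolding index_maps_def
    by (rule fold_row_Z[OF is_ring_hom_scalar_fps refl order_refl])
  also have "\<dots> = (\<Sum>\<eta>\<in>index_maps n. \<Sum>\<sigma>\<in>image_perms n \<eta>. scalar_fps (sdet_weight n \<sigma> \<eta>) * ?b \<eta> \<sigma>)"
    by (intro sum.cong refl) (simp only: summand sum_distrib_left weight)
  finally show "(sdet :: ('m, 'l) reflection_algebra fps) = \<dots>" .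
  show "?b \<eta> \<sigma> = (\<Sum>s\<in>summation_idx n \<eta>.
      \<Prod>k\<leftarrow>[1..<n + 1]. b_shift (k - 1) (lower_idx n \<eta> \<sigma> s k) (upper_idx n \<eta> s k))"
    if "\<eta> \<in> index_maps n" "\<sigma> \<in> image_perms n \<eta>" for \<eta> \<sigma>
    using b_coeff_path[of n \<eta> \<sigma>, OF \<eta>[OF that(1)], where 'm = 'm and 'l = 'l] that(2) perms[of \<eta>] by auto
qed

end
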